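(* For every commutative $\mathbb{Q}$-algebra $R$ with unit and all $\lambda,\mu,\nu\in R$ there are bijections \[\operatorname{BM}(R)\simeq\operatorname{Hom}_{\mathbb{Q}\text{-alg}}(\mathcal{G}^{\operatorname{f}},R),\qquad \operatorname{BM}_{(\lambda,\mu,\nu)}(R)\simeq \operatorname{Hom}_{\mathbb{Q}\text{-alg}}\big(\mathcal{G}^{\operatorname{f}}/(\operatorname{f}(b_2)-\lambda,\operatorname{f}(b_4)-\mu,\operatorname{f}(b_6)-\nu),R\big),\] the first being given by $\varphi\mapsto\sum_{w\in\mathcal{B}^*}\varphi(\operatorname{f}(w))\,w$ (with inverse $\Phi\mapsto(\operatorname{f}(w)\mapsto(\Phi\mid w))$). In particular, $\operatorname{BM}$ is an affine scheme on commutative $\mathbb{Q}$-algebras represented by $\mathcal{G}^{\operatorname{f}}$, and $\operatorname{BM}_{(\lambda,\mu,\nu)}$ is an affine scheme represented by $\mathcal{G}^{\operatorname{f}}/(\operatorname{f}(b_2)-\lambda,\operatorname{f}(b_4)-\mu,\operatorname{f}(b_6)-\nu)$.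
   Context: Let $\mathcal{B}=\{b_0,b_1,b_2,\ldots\}$, $\mathcal{B}^*$ the set of words (empty word $\mathbf{1}$), $\mathbb{Q}\langle\mathcal{B}\rangle$ the free non-commutative polynomial algebra and $R\langle\langle\mathcal{B}\rangle\rangle$ the non-commutative power series with coefficients in $R$; $(\Phi\mid w)$ is the coefficient of the word $w$ in $\Phi$. The balanced quasi-shuffle product $\ast_b$ on $\mathbb{Q}\langle\mathcal{B}\rangle$: $\mathbf{1}\ast_b w=w\ast_b\mathbf{1}=w$, $b_iu\ast_b b_jv=b_i(u\ast_b b_jv)+b_j(b_iu\ast_b v)+\delta\,b_{i+j}(u\ast_b v)$ with $\delta=1$ if $i,j\geq1$ and $\delta=0$ otherwise. Let $\mathbb{Q}\langle\mathcal{B}\rangle^0$ be the span of words not starting with $b_0$, and $\tau:\mathbb{Q}\langle\mathcal{B}\rangle^0\to\mathbb{Q}\langle\mathcal{B}\rangle^0$ the $\mathbb{Q}$-linear involution $\tau(b_{k_1}b_0^{m_1}\cdots b_{k_d}b_0^{m_d})=b_{m_d+1}b_0^{k_d-1}\cdots b_{m_1+1}b_0^{k_1-1}$ ($k_i\geq1,m_i\geq0$), extended $R$-linearly and coefficientwise to power series. Define $\mathcal{G}^{\operatorname{f}}=(\mathbb{Q}\langle\mathcal{B}\rangle,\ast_b)/\operatorname{Rel}_{\tau,0}$, where $\operatorname{Rel}_{\tau,0}$ is the ideal (for $\ast_b$) generated by $b_0$ and all $w-\tau(w)$, $w\in\mathbb{Q}\langle\mathcal{B}\rangle^0$; $\operatorname{f}(w)$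 denotes the class of $w$. The coproduct $\Delta_b$ on $R\langle\langle\mathcal{B}\rangle\rangle$ is the concatenation-multiplicative continuous map with $\Delta_b(b_i)=\mathbf{1}\otimes b_i+b_i\otimes\mathbf{1}+\sum_{j=1}^{i-1}b_j\otimes b_{i-j}$. $\Pi_0$ is the $R$-linear projection onto power series supported on words not starting with $b_0$ (identity on such words, $0$ on words starting with $b_0$). $\operatorname{BM}(R)$ is the set of $\Phi\in R\langle\langle\mathcal{B}\rangle\rangle$ with (i) $(\Phi\mid b_0)=0$, (ii) $\Delta_b(\Phi)=\Phi\otimes\Phi$, (iii) $\tau(\Pi_0(\Phi))=\Pi_0(\Phi)$; and $\operatorname{BM}_{(\lambda,\mu,\nu)}(R)$ is the subset with additionally $(\Phi\mid b_2)=\lambda$, $(\Phi\mid b_4)=\mu$, $(\Phi\mid b_6)=\nu$.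
   Formalization: BM(R) also requires (Φ|1)=1, since Φ=0 satisfies (i)–(iii) but comes from no unital hom; for λ,μ,ν in R the undefined quotient of G^f is read as one of R⊗G^f with R-algebra homs (functor on R-algebras), while for rational λ,μ,ν the literal quotient is treated. *)

theory Defs
  imports Complex_Main "HOL-Library.Multiset" "HOL-Library.FuncSet" "HOL-Algebra.QuotRing" "HOL-Algebra.Module"
begin

section \<open>Algebras over a commutative ring\<close>

text \<open>
  The locale \<^locale>\<open>algebra\<close> describes commutative unital algebras; the zero ring is allowed.
\<close>

definition rat_ring :: "rat ring" where
  "rat_ring = \<lparr>carrier = UNIV, monoid.mult = (*), one = 1, zero = 0, add = (+)\<rparr>"

definition self_alg :: "('r, 'm) ring_scheme \<Rightarrow> ('r, 'r) module" where
  "self_alg R = \<lparr>carrier = carrier R, monoid.mult = monoid.mult R, one = one R,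
     zero = zero R, add = add R, smult = monoid.mult R\<rparr>"

text \<open>
  Unital homomorphisms of \<open>K\<close>-algebras. They are taken to be extensional (with value
  \<^const>\<open>undefined\<close> off the carrier), so that distinct elements are distinct maps.
\<close>

definition alg_hom ::
  "('k, 'l) ring_scheme \<Rightarrow> ('k, 'a, 'm) module_scheme \<Rightarrow> ('k, 'b, 'n) module_scheme \<Rightarrow> ('a \<Rightarrow> 'b) set"
where
  "alg_hom K A B = {h \<in> ring_hom A B. h \<in> extensional (carrier A) \<and>
     (\<forall>k\<in>carrier K. \<forall>a\<in>carrier A. h (k \<odot>\<^bsub>A\<^esub> a) = k \<odot>\<^bsub>B\<^esub> h a)}"

text \<open>\<^const>\<open>FactRing\<close> with the induced scalar multiplication.\<close>

definition alg_quot :: "('k, 'a, 'm) module_scheme \<Rightarrow> 'a set \<Rightarrow> ('k, 'a set) module" where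
  "alg_quot A I = \<lparr>carrier = carrier (A Quot I), monoid.mult = monoid.mult (A Quot I),
     one = one (A Quot I), zero = zero (A Quot I), add = add (A Quot I),
     smult = (\<lambda>k C. \<Union>x\<in>C. I +>\<^bsub>A\<^esub> (k \<odot>\<^bsub>A\<^esub> x))\<rparr>"

text \<open>
  The free \<open>K\<close>-module on a set \<open>B\<close> (finitely supported functions vanishing off \<open>B\<close>) with the
  \<open>K\<close>-bilinear product that extends a product \<open>m\<close> of basis elements. The value \<open>m x y\<close> is a
  linear combination of basis elements with coefficients in the natural numbers, encoded as a
  multiset; \<open>e\<close> is the basis element serving as unit.
\<close>

definition lin_alg ::
  "('k, 'l) ring_scheme \<Rightarrow> 'x set \<Rightarrow> ('x \<Rightarrow> 'x \<Rightarrow> 'x multiset) \<Rightarrow> 'x \<Rightarrow> ('k, 'x \<Rightarrow> 'k) module"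
where
  "lin_alg K B m e =
    \<lparr>carrier = {f. (\<forall>x. f x \<in> carrier K) \<and> (\<forall>x. x \<notin> B \<longrightarrow> f x = \<zero>\<^bsub>K\<^esub>) \<and>
                   finite {x. f x \<noteq> \<zero>\<^bsub>K\<^esub>}},
     monoid.mult = (\<lambda>f g x. finsum K (\<lambda>(y, z). [count (m y z) x] \<cdot>\<^bsub>K\<^esub> (f y \<otimes>\<^bsub>K\<^esub> g z))
                       ({y. f y \<noteq> \<zero>\<^bsub>K\<^esub>} \<times> {z. g z \<noteq> \<zero>\<^bsub>K\<^esub>})),
     one = (\<lambda>x. if x = e then \<one>\<^bsub>K\<^esub> else \<zero>\<^bsub>K\<^esub>),
     zero = (\<lambda>x. \<zero>\<^bsub>K\<^esub>),
     add = (\<lambda>f g x. f x \<oplus>\<^bsub>K\<^esub> g x),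
     smult = (\<lambda>k f x. k \<otimes>\<^bsub>K\<^esub> f x)\<rparr>"

definition basis_elem :: "('k, 'l) ring_scheme \<Rightarrow> 'x \<Rightarrow> 'x \<Rightarrow> 'k" where
  "basis_elem K x = (\<lambda>y. if y = x then \<one>\<^bsub>K\<^esub> else \<zero>\<^bsub>K\<^esub>)"

text \<open>
  The tensor product of \<open>K\<close>-algebras \<open>R\<close> and \<open>A\<close> over \<open>K\<close>, as an \<open>R\<close>-algebra: the free \<open>R\<close>-module
  on symbols \<open>[a]\<close> with \<open>a\<close> in \<open>A\<close>, where \<open>r[a]\<close> stands for the tensor of \<open>r\<close> and \<open>a\<close>, modulo
  \<open>[a + b] = [a] + [b]\<close> and \<open>[ka] = (k1)[a]\<close>. The product is \<open>[a][b] = [ab]\<close>; as the set of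
  relations is stable under multiplication by every \<open>[c]\<close>, the ideal it generates is the
  \<open>R\<close>-submodule it generates.
\<close>

definition symbol_alg ::
  "('k, 'r, 'm) module_scheme \<Rightarrow> ('k, 'a, 'n) module_scheme \<Rightarrow> ('r, 'a \<Rightarrow> 'r) module"
where
  "symbol_alg R A = lin_alg R (carrier A) (\<lambda>a b. {#a \<otimes>\<^bsub>A\<^esub> b#}) \<one>\<^bsub>A\<^esub>"

definition tensor_ideal ::
  "('k, 'l) ring_scheme \<Rightarrow> ('k, 'r, 'm) module_scheme \<Rightarrow> ('k, 'a, 'n) module_scheme \<Rightarrow> ('a \<Rightarrow> 'r) set"
where
  "tensor_ideal K R A = Idl\<^bsub>symbol_alg R A\<^esub>
     ({basis_elem R (a \<oplus>\<^bsub>A\<^esub> b) \<ominus>\<^bsub>symbol_alg R A\<^esub>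
         (basis_elem R a \<oplus>\<^bsub>symbol_alg R A\<^esub> basis_elem R b) |a b. a \<in> carrier A \<and> b \<in> carrier A} \<union>
      {basis_elem R (k \<odot>\<^bsub>A\<^esub> a) \<ominus>\<^bsub>symbol_alg R A\<^esub>
         ((k \<odot>\<^bsub>R\<^esub> \<one>\<^bsub>R\<^esub>) \<odot>\<^bsub>symbol_alg R A\<^esub> basis_elem R a) |k a. k \<in> carrier K \<and> a \<in> carrier A})"

definition base_change ::
  "('k, 'l) ring_scheme \<Rightarrow> ('k, 'r, 'm) module_scheme \<Rightarrow> ('k, 'a, 'n) module_scheme
    \<Rightarrow> ('r, ('a \<Rightarrow> 'r) set) module"
where
  "base_change K R A = alg_quot (symbol_alg R A) (tensor_ideal K R A)"

definition one_tensor ::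
  "('k, 'l) ring_scheme \<Rightarrow> ('k, 'r, 'm) module_scheme \<Rightarrow> ('k, 'a, 'n) module_scheme
    \<Rightarrow> 'a \<Rightarrow> ('a \<Rightarrow> 'r) set"
where
  "one_tensor K R A a = tensor_ideal K R A +>\<^bsub>symbol_alg R A\<^esub> basis_elem R a"


section \<open>Words, the balanced quasi-shuffle product and the involution\<close>

text \<open>The word \<open>b\<^sub>i b\<^sub>j \<dots>\<close> is the list \<open>[i, j, \<dots>]\<close>.\<close>

type_synonym word = "nat list"

fun qshuffle :: "word \<Rightarrow> word \<Rightarrow> word multiset" where
  "qshuffle [] w = {#w#}"
| "qshuffle w [] = {#w#}"
| "qshuffle (i # u) (j # v) =
     image_mset ((#) i) (qshuffle u (j # v)) + image_mset ((#) j) (qshuffle (i # u) v) +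
     (if 1 \<le> i \<and> 1 \<le> j then image_mset ((#) (i + j)) (qshuffle u v) else {#})"

definition QB :: "(rat, word \<Rightarrow> rat) module" where
  "QB = lin_alg rat_ring UNIV qshuffle []"

definition words0 :: "word set" where
  "words0 = {w. w = [] \<or> hd w \<noteq> 0}"

definition word_of_blocks :: "(nat \<times> nat) list \<Rightarrow> word" where
  "word_of_blocks kms = concat (map (\<lambda>(k, m). k # replicate m 0) kms)"

text \<open>
  Every word in \<^term>\<open>words0\<close> is \<open>word_of_blocks [(k\<^sub>1, m\<^sub>1), \<dots>, (k\<^sub>d, m\<^sub>d)]\<close> for exactly one list
  of pairs with all \<open>k\<^sub>i \<ge> 1\<close>; on other words the value of \<open>tau_word\<close> is irrelevant.
\<close>

definition tau_word :: "word \<Rightarrow> word" where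
  "tau_word w = word_of_blocks (rev (map (\<lambda>(k, m). (m + 1, k - 1))
     (THE kms. (\<forall>(k, m)\<in>set kms. 1 \<le> k) \<and> word_of_blocks kms = w)))"

text \<open>
  The linear extension to series (in particular polynomials) supported on \<^term>\<open>words0\<close>. Each
  sum has one summand if \<open>v \<in> words0\<close> and is empty otherwise.
\<close>

definition tau :: "('r, 'm) ring_scheme \<Rightarrow> (word \<Rightarrow> 'r) \<Rightarrow> (word \<Rightarrow> 'r)" where
  "tau R \<Phi> = (\<lambda>v. \<Oplus>\<^bsub>R\<^esub>w\<in>{w \<in> words0. tau_word w = v}. \<Phi> w)"


section \<open>The algebra \<open>G\<^sup>f\<close>\<close>

definition Rel_tau0 :: "(word \<Rightarrow> rat) set" where
  "Rel_tau0 = Idl\<^bsub>QB\<^esub> ({basis_elem rat_ring [0]} \<union>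
     {p \<ominus>\<^bsub>QB\<^esub> tau rat_ring p |p. p \<in> carrier QB \<and> (\<forall>w. w \<notin> words0 \<longrightarrow> p w = 0)})"

definition Gf :: "(rat, (word \<Rightarrow> rat) set) module" where
  "Gf = alg_quot QB Rel_tau0"

definition f_class :: "word \<Rightarrow> (word \<Rightarrow> rat) set" where
  "f_class w = Rel_tau0 +>\<^bsub>QB\<^esub> basis_elem rat_ring w"

text \<open>
  For an algebra \<open>A\<close> with a distinguished element \<open>c w\<close> for every word \<open>w\<close>, the quotient
  \<open>A/(c(b\<^sub>2) - l, c(b\<^sub>4) - m, c(b\<^sub>6) - n)\<close> by scalars \<open>l, m, n\<close>, and the classes of the \<open>c w\<close> in it.
\<close>

definition param_ideal ::
  "('k, 'a, 'm) module_scheme \<Rightarrow> (word \<Rightarrow> 'a) \<Rightarrow> 'k \<Rightarrow> 'k \<Rightarrow> 'k \<Rightarrow> 'a set"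
where
  "param_ideal A c l m n = Idl\<^bsub>A\<^esub>
     {c [2] \<ominus>\<^bsub>A\<^esub> (l \<odot>\<^bsub>A\<^esub> \<one>\<^bsub>A\<^esub>), c [4] \<ominus>\<^bsub>A\<^esub> (m \<odot>\<^bsub>A\<^esub> \<one>\<^bsub>A\<^esub>), c [6] \<ominus>\<^bsub>A\<^esub> (n \<odot>\<^bsub>A\<^esub> \<one>\<^bsub>A\<^esub>)}"

definition param_quot ::
  "('k, 'a, 'm) module_scheme \<Rightarrow> (word \<Rightarrow> 'a) \<Rightarrow> 'k \<Rightarrow> 'k \<Rightarrow> 'k \<Rightarrow> ('k, 'a set) module"
where
  "param_quot A c l m n = alg_quot A (param_ideal A c l m n)"

definition param_class ::
  "('k, 'a, 'm) module_scheme \<Rightarrow> (word \<Rightarrow> 'a) \<Rightarrow> 'k \<Rightarrow> 'k \<Rightarrow> 'k \<Rightarrow> word \<Rightarrow> 'a set"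
where
  "param_class A c l m n w = param_ideal A c l m n +>\<^bsub>A\<^esub> c w"


section \<open>Power series and the sets \<open>BM\<close>\<close>

definition series :: "('r, 'm) ring_scheme \<Rightarrow> (word \<Rightarrow> 'r) set" where
  "series R = {\<Phi>. \<forall>w. \<Phi> w \<in> carrier R}"

text \<open>The pair \<open>(u, v)\<close> stands for the tensor of \<open>u\<close> and \<open>v\<close>; multiplicities are coefficients.\<close>

definition coprod_letter :: "nat \<Rightarrow> (word \<times> word) multiset" where
  "coprod_letter i = {#([], [i]), ([i], [])#} + image_mset (\<lambda>j. ([j], [i - j])) (mset_set {1..<i})"

fun coprod_word :: "word \<Rightarrow> (word \<times> word) multiset" where
  "coprod_word [] = {#([], [])#}"
| "coprod_word (i # w) =
     (\<Sum>(a, b)\<in>#coprod_letter i. image_mset (\<lambda>(c, d). (a @ c, b @ d)) (coprod_word w))"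

text \<open>
  The \<open>R\<close>-linear continuous extension to series. Only finitely many words contribute to a given
  pair, since the coproduct preserves the sum of the indices and the number of letters \<open>b\<^sub>0\<close>.
\<close>

definition coprod :: "('r, 'm) ring_scheme \<Rightarrow> (word \<Rightarrow> 'r) \<Rightarrow> (word \<times> word \<Rightarrow> 'r)" where
  "coprod R \<Phi> = (\<lambda>p. \<Oplus>\<^bsub>R\<^esub>w\<in>{w. p \<in># coprod_word w}. [count (coprod_word w) p] \<cdot>\<^bsub>R\<^esub> \<Phi> w)"

definition tensor_series ::
  "('r, 'm) ring_scheme \<Rightarrow> (word \<Rightarrow> 'r) \<Rightarrow> (word \<Rightarrow> 'r) \<Rightarrow> (word \<times> word \<Rightarrow> 'r)"
where
  "tensor_series R \<Phi> \<Psi> = (\<lambda>(u, v). \<Phi> u \<otimes>\<^bsub>R\<^esub> \<Psi> v)"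

definition Pi0 :: "('r, 'm) ring_scheme \<Rightarrow> (word \<Rightarrow> 'r) \<Rightarrow> (word \<Rightarrow> 'r)" where
  "Pi0 R \<Phi> = (\<lambda>w. if w \<in> words0 then \<Phi> w else \<zero>\<^bsub>R\<^esub>)"

text \<open>
  Group-like elements have constant term \<open>1\<close>. The equation \<open>\<Delta>\<^sub>b \<Phi> = \<Phi> \<otimes> \<Phi>\<close> alone only makes the
  constant term idempotent; it also holds for \<open>\<Phi> = 0\<close>, which is not the coefficient series of a
  unital homomorphism unless \<open>R\<close> is zero.
\<close>

definition grouplike :: "('r, 'm) ring_scheme \<Rightarrow> (word \<Rightarrow> 'r) \<Rightarrow> bool" where
  "grouplike R \<Phi> \<longleftrightarrow> \<Phi> [] = \<one>\<^bsub>R\<^esub> \<and> coprod R \<Phi> = tensor_series R \<Phi> \<Phi>"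

definition BM :: "('r, 'm) ring_scheme \<Rightarrow> (word \<Rightarrow> 'r) set" where
  "BM R = {\<Phi> \<in> series R. \<Phi> [0] = \<zero>\<^bsub>R\<^esub> \<and> grouplike R \<Phi> \<and> tau R (Pi0 R \<Phi>) = Pi0 R \<Phi>}"

definition BM_param :: "('r, 'm) ring_scheme \<Rightarrow> 'r \<Rightarrow> 'r \<Rightarrow> 'r \<Rightarrow> (word \<Rightarrow> 'r) set" where
  "BM_param R l m n = {\<Phi> \<in> BM R. \<Phi> [2] = l \<and> \<Phi> [4] = m \<and> \<Phi> [6] = n}"

text \<open>The series \<open>\<Sum>\<^sub>w \<phi>(c(w)) w\<close>.\<close>

definition coeff_series :: "(word \<Rightarrow> 'a) \<Rightarrow> ('a \<Rightarrow> 'r) \<Rightarrow> (word \<Rightarrow> 'r)" where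
  "coeff_series c \<phi> = (\<lambda>w. \<phi> (c w))"

end

theory Submission
  imports Defs
begin

text \<open>
  The coproduct \<open>\<Delta>\<^sub>b\<close> is dual to \<open>*\<^sub>b\<close>: the multiplicity of \<open>u \<otimes> v\<close> in \<open>\<Delta>\<^sub>b(w)\<close> equals the
  multiplicity of \<open>w\<close> in \<open>u *\<^sub>b v\<close>. Hence a series is group-like iff its coefficients define an algebra
  homomorphism on \<open>(\<rat>\<langle>B\<rangle>, *\<^sub>b)\<close>, and the other two conditions on \<open>\<Phi>\<close> say that this
  homomorphism kills the generators of \<open>Rel\<^sub>\<tau>\<^sub>,\<^sub>0\<close>. The rest is the composition of
  universal properties: of a free module with a product given on the basis, of a quotient by an
  ideal with given generators, and of the extension of scalars.
\<close>

text \<open>For parameters in \<open>R\<close> that are not rational, \<open>f_class [2] - l\<close>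
  has no meaning in \<open>Gf\<close>. The quotient is therefore formed in the
  \<open>R\<close>-algebra \<open>base_change rat_ring R Gf\<close>, and its homomorphisms are
  \<open>R\<close>-linear; the bijection with \<open>BM_param R l m n\<close> is the value of the
  represented functor at \<open>self_alg R\<close>. For rational parameters the quotient is formed
  in \<open>Gf\<close> itself. Every universal property is stated as an explicit bijection between
  sets of extensional homomorphisms, given by evaluation at distinguished elements. Composites of
  such bijections are again of the form \<open>coeff_series\<close>, so the description of the
  inverse and the naturality follow from bijectivity alone. Passing to a quotient by generators
  always corresponds to cutting out a subset of series by a predicate.\<close>

section \<open>Words\<close>

lemma qshuffle_Nil_right [simp]: "qshuffle w [] = {#w#}"
  by (cases w) auto

lemma qshuffle_commute: "qshuffle u v = qshuffle v u"
  by (induction u v rule: qshuffle.induct) (auto simp: ac_simps)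

text \<open>Keeping \<open>image_mset ((#) a) M\<close> unsplit in the second summand lets these
  summands recombine: added over the clauses of \<open>qshuffle (i # u) (j # v)\<close>, they give
  back the whole product, multiplied by \<open>w\<close>, behind the letter
  \<open>k\<close>.\<close>

lemma sum_mset_qshuffle_image_Cons:
  "(\<Sum>p\<in>#image_mset ((#) a) M. qshuffle p (k # w)) =
     image_mset ((#) a) (\<Sum>p\<in>#M. qshuffle p (k # w)) +
     image_mset ((#) k) (\<Sum>p\<in>#image_mset ((#) a) M. qshuffle p w) +
     (if 1 \<le> a \<and> 1 \<le> k then image_mset ((#) (a + k)) (\<Sum>p\<in>#M. qshuffle p w) else {#})"
  by (induction M) (auto simp: ac_simps)

text \<open>
  The right-hand side is symmetric under the cyclic shift of \<open>(i, u), (j, v), (k, w)\<close> as soon as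
  associativity is known for shorter words; so associativity is proved by induction in the
  form \<open>(u * v) * w = (v * w) * u\<close>.
\<close>

lemma sum_mset_qshuffle_Cons:
  "(\<Sum>p\<in>#qshuffle (i # u) (j # v). qshuffle p (k # w)) =
     image_mset ((#) i) (\<Sum>p\<in>#qshuffle u (j # v). qshuffle p (k # w)) +
     image_mset ((#) j) (\<Sum>p\<in>#qshuffle (i # u) v. qshuffle p (k # w)) +
     image_mset ((#) k) (\<Sum>p\<in>#qshuffle (i # u) (j # v). qshuffle p w) +
     (if 1 \<le> i \<and> 1 \<le> k
      then image_mset ((#) (i + k)) (\<Sum>p\<in>#qshuffle u (j # v). qshuffle p w) else {#}) +
     (if 1 \<le> j \<and> 1 \<le> k
      then image_mset ((#) (j + k)) (\<Sum>p\<in>#qshuffle (i # u) v. qshuffle p w) else {#}) +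
     (if 1 \<le> i \<and> 1 \<le> j
      then image_mset ((#) (i + j)) (\<Sum>p\<in>#qshuffle u v. qshuffle p (k # w)) else {#}) +
     (if 1 \<le> i \<and> 1 \<le> j \<and> 1 \<le> k
      then image_mset ((#) (i + j + k)) (\<Sum>p\<in>#qshuffle u v. qshuffle p w) else {#})"
  by (cases "1 \<le> i \<and> 1 \<le> j")
    (simp_all only: qshuffle.simps image_mset_union sum_mset.union sum_mset_qshuffle_image_Cons
      if_True if_False conj_assoc simp_thms image_mset_empty sum_mset.empty add_0_right,
     auto simp: ac_simps)

lemma qshuffle_assoc:
  "(\<Sum>p\<in>#qshuffle u v. qshuffle p w) = (\<Sum>p\<in>#qshuffle v w. qshuffle u p)"
proof -
  have "(\<Sum>p\<in>#qshuffle u v. qshuffle p w) = (\<Sum>p\<in>#qshuffle v w. qshuffle p u)"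
  proof (induction "length u + length v + length w" arbitrary: u v w rule: less_induct)
    case less
    show ?case
    proof (cases "u = [] \<or> v = [] \<or> w = []")
      case True
      then show ?thesis by (auto simp: qshuffle_commute)
    next
      case False
      then obtain i u' j v' k w' where eq: "u = i # u'" "v = j # v'" "w = k # w'"
        by (meson neq_Nil_conv)
      \<comment> \<open>One instance for each nonempty set of words that lose their head, that is,
        for each of the seven summands of the expansion. After rewriting with them, the two
        expansions differ only in the order of summands and in the order of addition of
        indices.\<close>
      have IH:
        "(\<Sum>p\<in>#qshuffle u' v. qshuffle p w) = (\<Sum>p\<in>#qshuffle v w. qshuffle p u')"
        "(\<Sum>p\<in>#qshuffle u v'. qshuffle p w) = (\<Sum>p\<in>#qshuffle v' w. qshuffle p u)"
        "(\<Sum>p\<in>#qshuffle u v. qshuffle p w') = (\<Sum>p\<in>#qshuffle v w'. qshuffle p u)"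
        "(\<Sum>p\<in>#qshuffle u' v'. qshuffle p w) = (\<Sum>p\<in>#qshuffle v' w. qshuffle p u')"
        "(\<Sum>p\<in>#qshuffle u v'. qshuffle p w') = (\<Sum>p\<in>#qshuffle v' w'. qshuffle p u)"
        "(\<Sum>p\<in>#qshuffle u' v. qshuffle p w') = (\<Sum>p\<in>#qshuffle v w'. qshuffle p u')"
        "(\<Sum>p\<in>#qshuffle u' v'. qshuffle p w') = (\<Sum>p\<in>#qshuffle v' w'. qshuffle p u')"
        by (rule less; simp add: eq)+
      show ?thesis
        unfolding eq sum_mset_qshuffle_Cons IH[unfolded eq] by (simp only: ac_simps conj_ac)
    qed
  qed
  then show ?thesis by (simp only: qshuffle_commute)
qed

section \<open>Duality between the coproduct of words and the quasi-shuffle product\<close>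

lemma count_image_Cons:
  "count (image_mset ((#) i) M) w = (case w of [] \<Rightarrow> 0 | j # v \<Rightarrow> if i = j then count M v else 0)"
proof (cases w)
  case Nil
  then show ?thesis by (auto simp: count_eq_zero_iff)
next
  case (Cons j v)
  then show ?thesis
    by (induction M) (auto simp: Cons)
qed

text \<open>The first letter goes to the right factor, goes to the left factor, or is split into two
  positive indices. Written with heads instead of concatenations, the recursion has the same three
  kinds of terms as \<open>qshuffle\<close>.\<close>

lemma coprod_word_Cons:
  "coprod_word (i # w) =
     image_mset (\<lambda>(c, d). (c, i # d)) (coprod_word w) +
     image_mset (\<lambda>(c, d). (i # c, d)) (coprod_word w) +
     (\<Sum>j = 1..<i. image_mset (\<lambda>(c, d). (j # c, (i - j) # d)) (coprod_word w))"
proof -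
  have "image_mset (\<lambda>(c, d). ([] @ c, [i] @ d)) M = image_mset (\<lambda>(c, d). (c, i # d)) M"
    "image_mset (\<lambda>(c, d). ([i] @ c, [] @ d)) M = image_mset (\<lambda>(c, d). (i # c, d)) M"
    for M :: "(word \<times> word) multiset"
    by simp_all
  then show ?thesis
    by (simp only: coprod_word.simps coprod_letter_def sum_unfold_sum_mset image_mset_union
        sum_mset.union image_mset_add_mset sum_mset.add_mset prod.case append_Nil append_Cons)
      (simp add: multiset.map_comp comp_def add_ac)
qed

lemma count_image_Cons_snd:
  "count (image_mset (\<lambda>(c, d). (c, i # d)) M) (u, v) =
     (case v of [] \<Rightarrow> 0 | k # v' \<Rightarrow> if i = k then count M (u, v') else 0)"
  by (induction M) (auto split: list.splits)

lemma count_image_Cons_fst: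
  "count (image_mset (\<lambda>(c, d). (i # c, d)) M) (u, v) =
     (case u of [] \<Rightarrow> 0 | k # u' \<Rightarrow> if i = k then count M (u', v) else 0)"
  by (induction M) (auto split: list.splits)

lemma count_image_Cons_both:
  "count (image_mset (\<lambda>(c, d). (i # c, j # d)) M) (u, v) =
     (case (u, v) of (k # u', l # v') \<Rightarrow> if i = k \<and> j = l then count M (u', v') else 0 | _ \<Rightarrow> 0)"
  by (induction M) (auto split: list.splits)

text \<open>Induction on \<open>w\<close>: its first letter is the head of \<open>v\<close>, the
  head of \<open>u\<close>, or the sum of both heads. This matches the three summands of
  \<open>coprod_word_Cons\<close> with the three clauses of \<open>qshuffle\<close>.\<close>

lemma count_coprod_word: "count (coprod_word w) (u, v) = count (qshuffle u v) w"
proof (induction w arbitrary: u v)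
  case Nil
  show ?case
    by (cases "(u, v)" rule: qshuffle.cases) (auto simp: count_image_Cons)
next
  case (Cons i w)
  \<comment> \<open>For given heads \<open>k\<close> and \<open>l\<close> only the split
    \<open>j = k\<close> can contribute, and the range of \<open>j\<close> forces both heads to be
    positive. This is the factor delta in the definition of the product.\<close>
  have *: "(\<Sum>j = Suc 0..<i. if j = k \<and> i - j = l then N else 0) =
      (if 1 \<le> k \<and> 1 \<le> l \<and> i = k + l then N else 0)" for k l N :: nat
  proof -
    have "(\<Sum>j = Suc 0..<i. if j = k \<and> i - j = l then N else 0) =
        (\<Sum>j = Suc 0..<i. if k = j then (if i - k = l then N else 0) else 0)"
      by (rule sum.cong) auto
    also have "\<dots> = (if 1 \<le> k \<and> 1 \<le> l \<and> i = k + l then N else 0)"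
      by (subst sum.delta') auto
    finally show ?thesis .
  qed
  show ?case
    by (simp only: coprod_word_Cons count_union count_sum count_image_Cons_snd
          count_image_Cons_fst count_image_Cons_both Cons.IH)
      (cases "(u, v)" rule: qshuffle.cases;
       auto simp: count_image_Cons * split: list.splits)
qed

section \<open>Block decomposition and the involution on words\<close>

abbreviation blocks :: "(nat \<times> nat) list \<Rightarrow> bool" where
  "blocks kms \<equiv> \<forall>(k, m)\<in>set kms. 1 \<le> k"

lemma word_of_blocks_simps [simp]:
  "word_of_blocks [] = []"
  "word_of_blocks ((k, m) # kms) = k # replicate m 0 @ word_of_blocks kms"
  by (simp_all add: word_of_blocks_def)

lemma word_of_blocks_words0: "blocks kms \<Longrightarrow> word_of_blocks kms \<in> words0"
  by (cases kms) (auto simp: words0_def)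

text \<open>Strong induction on the length: the first letter with the maximal run of zeros after it
  forms one block, and what \<open>dropWhile\<close> leaves is again in
  \<open>words0\<close>.\<close>

lemma words0_imp_blocks: "w \<in> words0 \<Longrightarrow> \<exists>kms. blocks kms \<and> word_of_blocks kms = w"
proof (induction w rule: length_induct)
  case (1 w)
  show ?case
  proof (cases w)
    case Nil
    then show ?thesis by (intro exI[of _ "[]"]) auto
  next
    case (Cons k v)
    define m where "m = length (takeWhile (\<lambda>x. x = 0) v)"
    define w' where "w' = dropWhile (\<lambda>x. x = 0) v"
    have v: "v = replicate m 0 @ w'"
      unfolding m_def w'_def
      by (metis (mono_tags, lifting) replicate_eqI set_takeWhileD takeWhile_dropWhile_id)
    have "w' \<in> words0"
      using hd_dropWhile[of "\<lambda>x. x = 0" v] unfolding words0_def w'_def mem_Collect_eq by argo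
    moreover have "length w' < length w"
      by (simp add: Cons w'_def length_dropWhile_le le_imp_less_Suc)
    ultimately obtain kms where "blocks kms" "word_of_blocks kms = w'"
      using 1 by blast
    then show ?thesis
      using 1(2) by (intro exI[of _ "(k, m) # kms"]) (auto simp: Cons v words0_def)
  qed
qed

lemma replicate_0_append_inj:
  assumes "replicate m 0 @ v = replicate m' 0 @ v'" "v \<in> words0" "v' \<in> words0"
  shows "m = m' \<and> v = v'"
  using assms(1)
proof (induction m arbitrary: m')
  case 0
  with assms(2) show ?case by (cases m') (auto simp: words0_def)
next
  case (Suc m)
  with assms(3) show ?case by (cases m') (auto simp: words0_def)
qed

text \<open>Together with \<open>words0_imp_blocks\<close> this makes the definite description in
  \<open>tau_word\<close> denote. The first block is recovered because the word of the remaining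
  blocks lies in \<open>words0\<close>, so it cannot prolong the run of zeros.\<close>

lemma word_of_blocks_inj:
  "\<lbrakk>word_of_blocks kms = word_of_blocks lms; blocks kms; blocks lms\<rbrakk> \<Longrightarrow> kms = lms"
proof (induction kms arbitrary: lms)
  case Nil
  then show ?case by (cases lms) auto
next
  case (Cons km kms)
  obtain k m where km: "km = (k, m)" by force
  obtain l m' lms' where lms: "lms = (l, m') # lms'"
    using Cons.prems(1) by (cases lms) (auto simp: km)
  have "m = m' \<and> word_of_blocks kms = word_of_blocks lms'"
    using Cons.prems by (intro replicate_0_append_inj word_of_blocks_words0) (auto simp: km lms)
  with Cons show ?case by (auto simp: km lms)
qed

lemma tau_word_of_blocks:
  assumes "blocks kms"
  shows "tau_word (word_of_blocks kms) = word_of_blocks (rev (map (\<lambda>(k, m). (m + 1, k - 1)) kms))"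
proof -
  have "(THE lms. blocks lms \<and> word_of_blocks lms = word_of_blocks kms) = kms"
    using assms by (intro the_equality) (simp, elim conjE, rule word_of_blocks_inj)
  then show ?thesis by (simp add: tau_word_def)
qed

lemma tau_word_words0:
  assumes "w \<in> words0"
  shows "tau_word w \<in> words0"
proof -
  obtain kms where kms: "blocks kms" "word_of_blocks kms = w"
    using words0_imp_blocks[OF assms] by blast
  show ?thesis
    unfolding kms(2)[symmetric] tau_word_of_blocks[OF kms(1)]
    by (rule word_of_blocks_words0) auto
qed

lemma tau_word_tau_word:
  assumes "w \<in> words0"
  shows "tau_word (tau_word w) = w"
proof -
  obtain kms where kms: "blocks kms" "word_of_blocks kms = w"
    using words0_imp_blocks[OF assms] by blast
  let ?f = "\<lambda>(k, m). (m + 1, k - 1) :: nat \<times> nat"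
  have "blocks (rev (map ?f kms))" by auto
  then have "tau_word (tau_word w) = word_of_blocks (rev (map ?f (rev (map ?f kms))))"
    unfolding kms(2)[symmetric] tau_word_of_blocks[OF kms(1)] by (rule tau_word_of_blocks)
  \<comment> \<open>The reversals cancel, and \<open>(k, m)\<close> goes to
    \<open>(m + 1, k - 1)\<close> and then to \<open>(k - 1 + 1, m)\<close>. The truncated
    subtraction is undone because \<open>k\<close> is at least 1 in every block.\<close>
  also have "rev (map ?f (rev (map ?f kms))) = kms"
    using kms(1) by (induction kms) auto
  finally show ?thesis by (simp add: kms)
qed

text \<open>As \<open>tau_word\<close> is an involution of \<open>words0\<close>, the sum defining
  \<open>tau\<close> at \<open>v\<close> has the single term at \<open>tau_word v\<close>, or no
  term.\<close>

lemma tau_word_preimage: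
  "{w \<in> words0. tau_word w = v} = (if v \<in> words0 then {tau_word v} else {})"
  using tau_word_words0 by (auto simp: tau_word_tau_word)


section \<open>Homomorphisms of algebras\<close>

lemma alg_homD:
  assumes "h \<in> alg_hom K A T"
  shows "a \<in> carrier A \<Longrightarrow> h a \<in> carrier T"
    and "\<lbrakk>a \<in> carrier A; b \<in> carrier A\<rbrakk> \<Longrightarrow> h (a \<otimes>\<^bsub>A\<^esub> b) = h a \<otimes>\<^bsub>T\<^esub> h b"
    and "\<lbrakk>a \<in> carrier A; b \<in> carrier A\<rbrakk> \<Longrightarrow> h (a \<oplus>\<^bsub>A\<^esub> b) = h a \<oplus>\<^bsub>T\<^esub> h b"
    and "h \<one>\<^bsub>A\<^esub> = \<one>\<^bsub>T\<^esub>"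
    and "\<lbrakk>k \<in> carrier K; a \<in> carrier A\<rbrakk> \<Longrightarrow> h (k \<odot>\<^bsub>A\<^esub> a) = k \<odot>\<^bsub>T\<^esub> h a"
    and "h \<in> extensional (carrier A)"
  using assms by (auto simp: alg_hom_def ring_hom_def)

lemma alg_homI:
  assumes "\<And>a. a \<in> carrier A \<Longrightarrow> h a \<in> carrier T"
    and "\<And>a b. \<lbrakk>a \<in> carrier A; b \<in> carrier A\<rbrakk> \<Longrightarrow> h (a \<otimes>\<^bsub>A\<^esub> b) = h a \<otimes>\<^bsub>T\<^esub> h b"
    and "\<And>a b. \<lbrakk>a \<in> carrier A; b \<in> carrier A\<rbrakk> \<Longrightarrow> h (a \<oplus>\<^bsub>A\<^esub> b) = h a \<oplus>\<^bsub>T\<^esub> h b"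
    and "h \<one>\<^bsub>A\<^esub> = \<one>\<^bsub>T\<^esub>"
    and "\<And>k a. \<lbrakk>k \<in> carrier K; a \<in> carrier A\<rbrakk> \<Longrightarrow> h (k \<odot>\<^bsub>A\<^esub> a) = k \<odot>\<^bsub>T\<^esub> h a"
    and "h \<in> extensional (carrier A)"
  shows "h \<in> alg_hom K A T"
  using assms by (auto simp: alg_hom_def ring_hom_def)

lemma alg_hom_ring_hom_cring:
  assumes "algebra K A" "algebra K T" "h \<in> alg_hom K A T"
  shows "ring_hom_cring A T h"
  using assms by (auto simp: alg_hom_def intro!: ring_hom_cring.intro ring_hom_cring_axioms.intro
      dest: algebra.M_cring)

lemma alg_hom_minus:
  assumes A: "algebra K A" and T: "algebra K T" and h: "h \<in> alg_hom K A T"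
    and a: "a \<in> carrier A" and b: "b \<in> carrier A"
  shows "h (a \<ominus>\<^bsub>A\<^esub> b) = h a \<ominus>\<^bsub>T\<^esub> h b"
proof -
  interpret ring_hom_cring A T h
    by (rule alg_hom_ring_hom_cring[OF A T h])
  show ?thesis using a b by (simp add: a_minus_def)
qed

lemma (in abelian_group) minus_eq_zero_iff:
  "\<lbrakk>a \<in> carrier G; b \<in> carrier G\<rbrakk> \<Longrightarrow> a \<ominus> b = \<zero> \<longleftrightarrow> a = b"
  by (metis a_minus_def add.inv_solve_right' l_zero minus_closed zero_closed)

text \<open>Cuts a universal property down to the homomorphisms that kill given generators.\<close>

lemma bij_betw_Collect:
  assumes "bij_betw f A B" "\<And>a. a \<in> A \<Longrightarrow> P a \<longleftrightarrow> Q (f a)"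
  shows "bij_betw f {a \<in> A. P a} {b \<in> B. Q b}"
  using assms by (auto simp: bij_betw_def inj_on_def)

lemma compose_alg_hom:
  assumes "g \<in> alg_hom K T U" "h \<in> alg_hom K A T" "algebra K A"
  shows "compose (carrier A) g h \<in> alg_hom K A U"
proof -
  interpret algebra K A by fact
  show ?thesis
    using assms(1,2) by (intro alg_homI) (simp_all add: compose_eq compose_extensional alg_homD)
qed


section \<open>Free modules with a product on the basis\<close>

definition mset_comb :: "('t, 'p) ring_scheme \<Rightarrow> 'x multiset \<Rightarrow> ('x \<Rightarrow> 't) \<Rightarrow> 't" where
  "mset_comb T M H = (\<Oplus>\<^bsub>T\<^esub>x\<in>set_mset M. [count M x] \<cdot>\<^bsub>T\<^esub> H x)"

text \<open>For a \<open>K\<close>-algebra \<open>T\<close> these are the functions on the basis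
  that extend to algebra homomorphisms from \<open>lin_alg K B m e\<close> to \<open>T\<close>
  (\<open>lin_alg_universal\<close>). For words with the quasi-shuffle product they are the
  group-like series (\<open>mult_maps_qshuffle\<close>).\<close>

definition mult_maps ::
  "('t, 'p) ring_scheme \<Rightarrow> 'x set \<Rightarrow> ('x \<Rightarrow> 'x \<Rightarrow> 'x multiset) \<Rightarrow> 'x \<Rightarrow> ('x \<Rightarrow> 't) set"
where
  "mult_maps T B m e = {H \<in> B \<rightarrow>\<^sub>E carrier T. H e = \<one>\<^bsub>T\<^esub> \<and>
     (\<forall>u\<in>B. \<forall>v\<in>B. mset_comb T (m u v) H = H u \<otimes>\<^bsub>T\<^esub> H v)}"

lemma (in module) nat_smult:
  "x \<in> carrier M \<Longrightarrow> ([n] \<cdot> \<one>) \<odot>\<^bsub>M\<^esub> x = [(n::nat)] \<cdot>\<^bsub>M\<^esub> x"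
  by (induction n) (simp_all add: smult_l_distr)

text \<open>Conditions on the basis that make \<open>lin_alg\<close> a commutative algebra. There
  are two interpretations: words with \<open>qshuffle\<close>, where a product has many terms, and
  the elements of an algebra with one-term products, for the symbols from which a tensor product is
  built.\<close>

locale lin_alg_data = cring K for K (structure) +
  fixes B :: "'x set" and m :: "'x \<Rightarrow> 'x \<Rightarrow> 'x multiset" and e :: 'x
  assumes m_in: "\<lbrakk>x \<in> B; y \<in> B; z \<in># m x y\<rbrakk> \<Longrightarrow> z \<in> B"
    and e_in [simp]: "e \<in> B"
    and m_unit: "x \<in> B \<Longrightarrow> m e x = {#x#}"
    and m_commute: "\<lbrakk>x \<in> B; y \<in> B\<rbrakk> \<Longrightarrow> m x y = m y x"
    and m_mset_assoc: "\<lbrakk>x \<in> B; y \<in> B; z \<in> B\<rbrakk> \<Longrightarrow>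
      (\<Sum>p\<in>#m x y. m p z) = (\<Sum>p\<in>#m y z. m x p)"
begin

section \<open>The free module and its bilinear product\<close>

abbreviation "L \<equiv> lin_alg K B m e"
abbreviation "supp f \<equiv> {x. f x \<noteq> \<zero>}"

lemma L_simps:
  "\<zero>\<^bsub>L\<^esub> = (\<lambda>x. \<zero>)" "f \<oplus>\<^bsub>L\<^esub> g = (\<lambda>x. f x \<oplus> g x)" "k \<odot>\<^bsub>L\<^esub> f = (\<lambda>x. k \<otimes> f x)"
  "\<one>\<^bsub>L\<^esub> = basis_elem K e"
  by (simp_all add: lin_alg_def basis_elem_def)

lemma carrier_L: "f \<in> carrier L \<longleftrightarrow> (\<forall>x. f x \<in> carrier K) \<and> supp f \<subseteq> B \<and> finite (supp f)"
  by (auto simp: lin_alg_def)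

lemma L_value [simp]: "f \<in> carrier L \<Longrightarrow> f x \<in> carrier K"
  by (simp add: carrier_L)

lemma L_zero_closed: "(\<lambda>x. \<zero>) \<in> carrier L"
  by (simp add: carrier_L)

lemma L_add_closed:
  assumes "f \<in> carrier L" "g \<in> carrier L"
  shows "(\<lambda>x. f x \<oplus> g x) \<in> carrier L"
proof -
  have "supp (\<lambda>x. f x \<oplus> g x) \<subseteq> supp f \<union> supp g"
    using assms by auto
  with assms show ?thesis
    unfolding carrier_L by (blast intro: finite_subset a_closed)
qed

lemma L_map_closed:
  assumes "f \<in> carrier L" "\<And>a. a \<in> carrier K \<Longrightarrow> h a \<in> carrier K" "h \<zero> = \<zero>"
  shows "(\<lambda>x. h (f x)) \<in> carrier L"
proof -
  have "supp (\<lambda>x. h (f x)) \<subseteq> supp f"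
    using assms by auto
  with assms show ?thesis
    unfolding carrier_L by (blast intro: finite_subset)
qed

lemma L_smult_closed: "\<lbrakk>k \<in> carrier K; f \<in> carrier L\<rbrakk> \<Longrightarrow> (\<lambda>x. k \<otimes> f x) \<in> carrier L"
  by (rule L_map_closed[of f "\<lambda>a. k \<otimes> a"]) auto

lemma basis_closed: "x \<in> B \<Longrightarrow> basis_elem K x \<in> carrier L"
  by (auto simp: carrier_L basis_elem_def)

lemma L_abelian_group: "abelian_group L"
proof (rule abelian_groupI)
  fix f assume f: "f \<in> carrier L"
  then have "(\<lambda>x. \<ominus> f x) \<in> carrier L"
    using L_map_closed[of f "\<lambda>a. \<ominus> a"] by simp
  then show "\<exists>g\<in>carrier L. g \<oplus>\<^bsub>L\<^esub> f = \<zero>\<^bsub>L\<^esub>"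
    using f by (intro bexI[of _ "\<lambda>x. \<ominus> f x"]) (auto simp: L_simps l_neg)
qed (auto simp: L_simps L_add_closed L_zero_closed a_ac intro: ext)

lemma L_module: "module K L"
  by (rule moduleI)
    (auto simp: L_abelian_group L_simps L_smult_closed l_distr r_distr m_assoc is_cring intro!: ext)

sublocale L: module K L
  by (rule L_module)

text \<open>Induction over a finite set containing the support, splitting off one coordinate at a
  time. It reduces linear and multilinear identities to basis elements.\<close>

lemma lin_induct [consumes 1, case_names basis add smult]:
  assumes f: "f \<in> carrier L"
    and basis: "\<And>x. x \<in> B \<Longrightarrow> P (basis_elem K x)"
    and add: "\<And>f g. \<lbrakk>f \<in> carrier L; g \<in> carrier L; P f; P g\<rbrakk> \<Longrightarrow> P (f \<oplus>\<^bsub>L\<^esub> g)"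
    and smult: "\<And>k f. \<lbrakk>k \<in> carrier K; f \<in> carrier L; P f\<rbrakk> \<Longrightarrow> P (k \<odot>\<^bsub>L\<^esub> f)"
  shows "P f"
proof -
  have "finite F \<Longrightarrow> f \<in> carrier L \<Longrightarrow> supp f \<subseteq> F \<Longrightarrow> P f" for F f
  proof (induction F arbitrary: f rule: finite_induct)
    case empty
    \<comment> \<open>The zero vector falls under the case \<open>smult\<close>: it is the zero
      multiple of a basis element, and \<open>e\<close> guarantees that there is one.\<close>
    then have "f = \<zero> \<odot>\<^bsub>L\<^esub> basis_elem K e"
      by (auto simp: L_simps basis_elem_def)
    then show ?case
      using smult[OF zero_closed basis_closed[OF e_in] basis[OF e_in]] by metis
  next
    case (insert x F)
    show ?case
    proof (cases "x \<in> B")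
      case False
      with insert.prems have "f x = \<zero>" by (auto simp: carrier_L)
      with insert.prems have "supp f \<subseteq> F" by auto
      with insert show ?thesis by blast
    next
      case True
      define g where "g = f(x := \<zero>)"
      have "supp g \<subseteq> supp f" by (auto simp: g_def)
      with insert.prems have g: "g \<in> carrier L"
        unfolding carrier_L by (auto simp: g_def intro: finite_subset)
      have "supp g \<subseteq> F"
        using insert.prems by (auto simp: g_def)
      with insert.IH g have "P g" by blast
      moreover have "f = f x \<odot>\<^bsub>L\<^esub> basis_elem K x \<oplus>\<^bsub>L\<^esub> g"
        using insert.prems by (auto simp: L_simps basis_elem_def g_def)
      moreover have "P (f x \<odot>\<^bsub>L\<^esub> basis_elem K x \<oplus>\<^bsub>L\<^esub> g)"
        using insert.prems(1) True
        by (intro add smult basis g \<open>P g\<close> L.smult_closed basis_closed L_value)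
      ultimately show ?thesis by metis
    qed
  qed
  with f show ?thesis by (auto simp: carrier_L)
qed

text \<open>The defining sum runs over the exact supports, which change under addition and scaling.
  Padding it with vanishing terms gives different products a common index set.\<close>

lemma mult_L:
  assumes f: "f \<in> carrier L" and g: "g \<in> carrier L"
    and fin: "finite F" "finite G" and supp: "supp f \<subseteq> F" "supp g \<subseteq> G"
  shows "(f \<otimes>\<^bsub>L\<^esub> g) x = (\<Oplus>p\<in>F \<times> G. [count (m (fst p) (snd p)) x] \<cdot> (f (fst p) \<otimes> g (snd p)))"
proof -
  have val: "f y \<in> carrier K" "g y \<in> carrier K" for y
    using f g by simp_all
  have "(f \<otimes>\<^bsub>L\<^esub> g) x =
      (\<Oplus>p\<in>supp f \<times> supp g. [count (m (fst p) (snd p)) x] \<cdot> (f (fst p) \<otimes> g (snd p)))"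
    unfolding lin_alg_def monoid.select_convs case_prod_beta' ..
  also have "\<dots> = (\<Oplus>p\<in>F \<times> G. [count (m (fst p) (snd p)) x] \<cdot> (f (fst p) \<otimes> g (snd p)))"
  proof (rule add.finprod_mono_neutral_cong_left)
    fix p assume "p \<in> F \<times> G - supp f \<times> supp g"
    then have "f (fst p) = \<zero> \<or> g (snd p) = \<zero>" by (cases p) auto
    then show "[count (m (fst p) (snd p)) x] \<cdot> (f (fst p) \<otimes> g (snd p)) = \<zero>"
      using val by auto
  next
    show "supp f \<times> supp g \<subseteq> F \<times> G" using supp by (rule Sigma_mono)
  qed (use val fin in auto)
  finally show ?thesis .
qed

lemma mult_L_closed:
  assumes f: "f \<in> carrier L" and g: "g \<in> carrier L"
  shows "f \<otimes>\<^bsub>L\<^esub> g \<in> carrier L"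
proof -
  have fin: "finite (supp f)" "finite (supp g)" and supp: "supp f \<subseteq> B" "supp g \<subseteq> B"
    using f g by (simp_all add: carrier_L)
  note mult = mult_L[OF f g fin subset_refl subset_refl]
  let ?S = "\<Union>p\<in>supp f \<times> supp g. set_mset (m (fst p) (snd p))"
  have "(f \<otimes>\<^bsub>L\<^esub> g) x = \<zero>" if x: "x \<notin> ?S" for x
    unfolding mult
  proof (rule add.finprod_one_eqI)
    fix p assume "p \<in> supp f \<times> supp g"
    with x have "x \<notin># m (fst p) (snd p)" by blast
    then have "count (m (fst p) (snd p)) x = 0" by (simp add: not_in_iff)
    then show "[count (m (fst p) (snd p)) x] \<cdot> (f (fst p) \<otimes> g (snd p)) = \<zero>" by simp
  qed
  then have S: "supp (f \<otimes>\<^bsub>L\<^esub> g) \<subseteq> ?S" by blast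
  have "finite ?S"
    by (intro finite_UN_I finite_cartesian_product fin finite_set_mset)
  with S have "finite (supp (f \<otimes>\<^bsub>L\<^esub> g))" by (rule finite_subset)
  moreover have "?S \<subseteq> B"
  proof
    fix x assume "x \<in> ?S"
    then obtain p where p: "p \<in> supp f \<times> supp g" "x \<in># m (fst p) (snd p)" by blast
    with supp have "fst p \<in> B" "snd p \<in> B" by auto
    with p(2) show "x \<in> B" by (rule m_in[rotated 2])
  qed
  with S have "supp (f \<otimes>\<^bsub>L\<^esub> g) \<subseteq> B" by (rule subset_trans)
  moreover have "(f \<otimes>\<^bsub>L\<^esub> g) x \<in> carrier K" for x
    unfolding mult using f g by (intro finsum_closed) simp
  ultimately show ?thesis
    unfolding carrier_L by blast
qed

lemma mult_L_add:
  assumes f: "f \<in> carrier L" and f': "f' \<in> carrier L" and g: "g \<in> carrier L"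
  shows "(f \<oplus>\<^bsub>L\<^esub> f') \<otimes>\<^bsub>L\<^esub> g = (f \<otimes>\<^bsub>L\<^esub> g) \<oplus>\<^bsub>L\<^esub> (f' \<otimes>\<^bsub>L\<^esub> g)"
proof
  fix x
  let ?F = "supp f \<union> supp f'"
  have fin: "finite ?F" "finite (supp g)"
    using f f' g by (auto simp: carrier_L)
  have "supp (f \<oplus>\<^bsub>L\<^esub> f') \<subseteq> ?F"
    using f f' by (auto simp: L_simps)
  then have "((f \<oplus>\<^bsub>L\<^esub> f') \<otimes>\<^bsub>L\<^esub> g) x =
      (\<Oplus>p\<in>?F \<times> supp g. [count (m (fst p) (snd p)) x] \<cdot> ((f \<oplus>\<^bsub>L\<^esub> f') (fst p) \<otimes> g (snd p)))"
    using f f' g fin by (intro mult_L) auto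
  also have "\<dots> = (\<Oplus>yz\<in>?F \<times> supp g.
      [count (m (fst yz) (snd yz)) x] \<cdot> (f (fst yz) \<otimes> g (snd yz)) \<oplus>
      [count (m (fst yz) (snd yz)) x] \<cdot> (f' (fst yz) \<otimes> g (snd yz)))"
    using f f' g by (intro finsum_cong') (auto simp: L_simps l_distr add.nat_pow_distrib)
  also have "\<dots> = (f \<otimes>\<^bsub>L\<^esub> g) x \<oplus> (f' \<otimes>\<^bsub>L\<^esub> g) x"
    using f f' g fin
    by (subst finsum_addf)
      (auto simp: mult_L[of f g ?F "supp g"] mult_L[of f' g ?F "supp g"] case_prod_beta)
  finally show "((f \<oplus>\<^bsub>L\<^esub> f') \<otimes>\<^bsub>L\<^esub> g) x = ((f \<otimes>\<^bsub>L\<^esub> g) \<oplus>\<^bsub>L\<^esub> (f' \<otimes>\<^bsub>L\<^esub> g)) x"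
    by (simp add: L_simps)
qed

lemma mult_L_smult:
  assumes k: "k \<in> carrier K" and f: "f \<in> carrier L" and g: "g \<in> carrier L"
  shows "(k \<odot>\<^bsub>L\<^esub> f) \<otimes>\<^bsub>L\<^esub> g = k \<odot>\<^bsub>L\<^esub> (f \<otimes>\<^bsub>L\<^esub> g)"
proof
  fix x
  have fin: "finite (supp f)" "finite (supp g)"
    using f g by (auto simp: carrier_L)
  have "supp (k \<odot>\<^bsub>L\<^esub> f) \<subseteq> supp f"
    using k f by (auto simp: L_simps)
  then have "((k \<odot>\<^bsub>L\<^esub> f) \<otimes>\<^bsub>L\<^esub> g) x =
      (\<Oplus>p\<in>supp f \<times> supp g. [count (m (fst p) (snd p)) x] \<cdot> ((k \<odot>\<^bsub>L\<^esub> f) (fst p) \<otimes> g (snd p)))"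
    using k f g fin by (intro mult_L) auto
  also have "\<dots> = (\<Oplus>yz\<in>supp f \<times> supp g.
      k \<otimes> [count (m (fst yz) (snd yz)) x] \<cdot> (f (fst yz) \<otimes> g (snd yz)))"
    using k f g by (intro finsum_cong') (auto simp: L_simps m_assoc add_pow_rdistr)
  also have "\<dots> = k \<otimes> (f \<otimes>\<^bsub>L\<^esub> g) x"
    using k f g fin
    by (subst finsum_rdistr[symmetric])
      (auto simp: mult_L[of f g "supp f" "supp g"] case_prod_beta)
  finally show "((k \<odot>\<^bsub>L\<^esub> f) \<otimes>\<^bsub>L\<^esub> g) x = (k \<odot>\<^bsub>L\<^esub> (f \<otimes>\<^bsub>L\<^esub> g)) x"
    by (simp add: L_simps)
qed

lemma mult_L_commute:
  assumes f: "f \<in> carrier L" and g: "g \<in> carrier L"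
  shows "f \<otimes>\<^bsub>L\<^esub> g = g \<otimes>\<^bsub>L\<^esub> f"
proof
  fix x
  have fin: "finite (supp f)" "finite (supp g)" "supp f \<subseteq> B" "supp g \<subseteq> B"
    using f g by (auto simp: carrier_L)
  have val: "f y \<in> carrier K" "g y \<in> carrier K" for y
    using f g by simp_all
  have "(f \<otimes>\<^bsub>L\<^esub> g) x =
      (\<Oplus>p\<in>prod.swap ` (supp g \<times> supp f). [count (m (fst p) (snd p)) x] \<cdot> (f (fst p) \<otimes> g (snd p)))"
    unfolding product_swap using fin by (intro mult_L f g) auto
  also have "\<dots> = (\<Oplus>p\<in>supp g \<times> supp f.
      [count (m (snd p) (fst p)) x] \<cdot> (f (snd p) \<otimes> g (fst p)))"
    using val by (subst finsum_reindex) (simp_all add: Pi_def)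
  also have "\<dots> = (\<Oplus>p\<in>supp g \<times> supp f. [count (m (fst p) (snd p)) x] \<cdot> (g (fst p) \<otimes> f (snd p)))"
  proof (rule finsum_cong')
    fix p assume "p \<in> supp g \<times> supp f"
    then have "fst p \<in> B" "snd p \<in> B" using fin by auto
    then show "[count (m (snd p) (fst p)) x] \<cdot> (f (snd p) \<otimes> g (fst p)) =
        [count (m (fst p) (snd p)) x] \<cdot> (g (fst p) \<otimes> f (snd p))"
      using val by (simp add: m_commute[of "fst p"] m_comm)
  qed (use val in \<open>simp_all add: Pi_def\<close>)
  also have "\<dots> = (g \<otimes>\<^bsub>L\<^esub> f) x"
    using fin by (intro mult_L[symmetric] f g) auto
  finally show "(f \<otimes>\<^bsub>L\<^esub> g) x = (g \<otimes>\<^bsub>L\<^esub> f) x" .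
qed

definition vec :: "'x multiset \<Rightarrow> 'x \<Rightarrow> 'a" where
  "vec M = (\<lambda>x. [count M x] \<cdot> \<one>)"

lemma vec_closed:
  assumes "set_mset M \<subseteq> B"
  shows "vec M \<in> carrier L"
proof -
  have "vec M x = \<zero>" if "x \<notin># M" for x
    using that by (simp add: vec_def not_in_iff)
  then have supp: "supp (vec M) \<subseteq> set_mset M" by blast
  then have "finite (supp (vec M))" by (rule finite_subset) simp
  with subset_trans[OF supp assms] show ?thesis
    by (simp add: carrier_L vec_def)
qed

lemma vec_single: "vec {#x#} = basis_elem K x"
  by (auto simp: vec_def basis_elem_def)

lemma vec_union: "vec (M + N) = vec M \<oplus>\<^bsub>L\<^esub> vec N"
  by (auto simp: vec_def L_simps add.nat_pow_mult)

lemma vec_empty: "vec {#} = \<zero>\<^bsub>L\<^esub>"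
  by (auto simp: vec_def L_simps)

lemma mult_basis:
  assumes "u \<in> B" "v \<in> B"
  shows "basis_elem K u \<otimes>\<^bsub>L\<^esub> basis_elem K v = vec (m u v)"
proof
  fix x
  have "(basis_elem K u \<otimes>\<^bsub>L\<^esub> basis_elem K v) x =
      (\<Oplus>p\<in>{u} \<times> {v}. [count (m (fst p) (snd p)) x] \<cdot> (basis_elem K u (fst p) \<otimes> basis_elem K v (snd p)))"
    using assms by (intro mult_L basis_closed) (auto simp: basis_elem_def)
  also have "\<dots> = vec (m u v) x"
    by (auto simp: vec_def basis_elem_def)
  finally show "(basis_elem K u \<otimes>\<^bsub>L\<^esub> basis_elem K v) x = vec (m u v) x" .
qed

text \<open>Turns a product of three basis elements into a sum of multisets, the form in which
  \<open>m_mset_assoc\<close> is phrased.\<close>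

lemma mult_vec_basis:
  assumes "set_mset M \<subseteq> B" "v \<in> B"
  shows "vec M \<otimes>\<^bsub>L\<^esub> basis_elem K v = vec (\<Sum>p\<in>#M. m p v)"
  using assms
proof (induction M)
  case empty
  \<comment> \<open>At this stage \<open>L\<close> is not yet known to be a ring, so annihilation by
    zero is taken from homogeneity with the scalar zero.\<close>
  have "\<zero>\<^bsub>L\<^esub> \<otimes>\<^bsub>L\<^esub> basis_elem K v = \<zero>\<^bsub>L\<^esub>"
    using mult_L_smult[of \<zero> "\<zero>\<^bsub>L\<^esub>" "basis_elem K v"] assms basis_closed mult_L_closed by simp
  then show ?case by (simp add: vec_empty)
next
  case (add p M)
  then have M: "set_mset M \<subseteq> B" and p: "p \<in> B" by simp_all
  have "vec (add_mset p M) \<otimes>\<^bsub>L\<^esub> basis_elem K v =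
      (vec M \<oplus>\<^bsub>L\<^esub> basis_elem K p) \<otimes>\<^bsub>L\<^esub> basis_elem K v"
    unfolding add_mset_add_single[of p M] vec_union vec_single ..
  also have "\<dots> = vec (\<Sum>p\<in>#M. m p v) \<oplus>\<^bsub>L\<^esub> vec (m p v)"
    using assms(2) M p add.IH by (simp only: mult_L_add vec_closed basis_closed mult_basis)
  also have "\<dots> = vec (\<Sum>p\<in>#add_mset p M. m p v)"
    by (simp add: vec_union[symmetric] add.commute)
  finally show ?case .
qed

lemma mult_L_one: "f \<in> carrier L \<Longrightarrow> \<one>\<^bsub>L\<^esub> \<otimes>\<^bsub>L\<^esub> f = f"
proof (induction f rule: lin_induct)
  case (basis x)
  then show ?case by (simp add: L_simps mult_basis m_unit vec_single)
next
  case (add f g)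
  then show ?case
    by (metis L_simps(4) basis_closed e_in mult_L_add mult_L_commute L.M.a_closed)
next
  case (smult k f)
  then show ?case
    by (metis L_simps(4) basis_closed e_in mult_L_smult mult_L_commute L.smult_closed)
qed

lemma mult_L_add_right:
  "\<lbrakk>f \<in> carrier L; g \<in> carrier L; g' \<in> carrier L\<rbrakk> \<Longrightarrow>
     f \<otimes>\<^bsub>L\<^esub> (g \<oplus>\<^bsub>L\<^esub> g') = (f \<otimes>\<^bsub>L\<^esub> g) \<oplus>\<^bsub>L\<^esub> (f \<otimes>\<^bsub>L\<^esub> g')"
  by (simp add: mult_L_commute[of f] mult_L_add)

lemma mult_L_smult_right:
  "\<lbrakk>k \<in> carrier K; f \<in> carrier L; g \<in> carrier L\<rbrakk> \<Longrightarrow>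
     f \<otimes>\<^bsub>L\<^esub> (k \<odot>\<^bsub>L\<^esub> g) = k \<odot>\<^bsub>L\<^esub> (f \<otimes>\<^bsub>L\<^esub> g)"
  by (simp add: mult_L_commute[of f] mult_L_smult)

lemmas mult_L_linear = mult_L_add mult_L_smult mult_L_add_right mult_L_smult_right

text \<open>Both sides are linear in each argument, so it suffices to compare them on three basis
  elements, where \<open>m_mset_assoc\<close> applies.\<close>

lemma mult_L_assoc:
  assumes "f \<in> carrier L" "g \<in> carrier L" "h \<in> carrier L"
  shows "(f \<otimes>\<^bsub>L\<^esub> g) \<otimes>\<^bsub>L\<^esub> h = f \<otimes>\<^bsub>L\<^esub> (g \<otimes>\<^bsub>L\<^esub> h)"
  using assms(1)
proof (induction f rule: lin_induct)
  case u: (basis u)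
  show ?case
    using assms(2)
  proof (induction g rule: lin_induct)
    case v: (basis v)
    show ?case
      using assms(3)
    proof (induction h rule: lin_induct)
      case w: (basis w)
      have mset: "set_mset (m u v) \<subseteq> B" "set_mset (m v w) \<subseteq> B"
        by (intro subsetI m_in[OF u v] m_in[OF v w]; assumption)+
      \<comment> \<open>\<open>mult_vec_basis\<close> expects the single basis element on the right.
        The factors are therefore swapped in \<open>L\<close>, and \<open>m_commute\<close> swaps
        them back inside the multiset.\<close>
      have "basis_elem K u \<otimes>\<^bsub>L\<^esub> vec (m v w) = vec (\<Sum>p\<in>#m v w. m p u)"
        using mset u by (simp add: mult_L_commute[of "basis_elem K u"] vec_closed basis_closed mult_vec_basis)
      also have "(\<Sum>p\<in>#m v w. m p u) = (\<Sum>p\<in>#m v w. m u p)"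
        using mset u by (intro arg_cong[where f = sum_mset] image_mset_cong m_commute) auto
      finally show ?case
        using mset u v w by (simp only: mult_basis mult_vec_basis m_mset_assoc)
    qed (simp_all add: mult_L_linear mult_L_closed basis_closed u v)
  qed (simp_all add: mult_L_linear mult_L_closed basis_closed u assms)
qed (simp_all add: mult_L_linear mult_L_closed assms)

lemma L_algebra: "algebra K L"
proof (rule algebraI)
  have "comm_monoid L"
    by (rule comm_monoidI)
      (erule (2) mult_L_assoc | erule (1) mult_L_closed mult_L_commute | erule mult_L_one |
       simp add: L_simps basis_closed)+
  then show "cring L"
    by (intro cringI) (auto simp: mult_L_add L_abelian_group)
qed (auto simp: mult_L_smult is_cring L.smult_l_distr L.smult_r_distr L.smult_assoc1)


section \<open>Linear extension and the universal property\<close>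

definition lin_ext :: "('a, 't, 'p) module_scheme \<Rightarrow> ('x \<Rightarrow> 't) \<Rightarrow> ('x \<Rightarrow> 'a) \<Rightarrow> 't" where
  "lin_ext T H f = (\<Oplus>\<^bsub>T\<^esub>x\<in>supp f. f x \<odot>\<^bsub>T\<^esub> H x)"

context
  fixes T :: "('a, 't, 'p) module_scheme" and H :: "'x \<Rightarrow> 't"
  assumes T: "algebra K T" and H: "\<And>x. x \<in> B \<Longrightarrow> H x \<in> carrier T"
begin

interpretation TR: cring T by (rule algebra.M_cring[OF T])
interpretation T: algebra K T by (fact T)

lemma lin_ext_eq:
  assumes f: "f \<in> carrier L" and F: "finite F" "F \<subseteq> B" "supp f \<subseteq> F"
  shows "lin_ext T H f = (\<Oplus>\<^bsub>T\<^esub>x\<in>F. f x \<odot>\<^bsub>T\<^esub> H x)"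
  unfolding lin_ext_def
proof (rule TR.add.finprod_mono_neutral_cong_left)
  fix x assume "x \<in> F - supp f"
  then have "f x = \<zero>" "H x \<in> carrier T" using F H by auto
  then show "f x \<odot>\<^bsub>T\<^esub> H x = \<zero>\<^bsub>T\<^esub>" by simp
next
  show "(\<lambda>x. f x \<odot>\<^bsub>T\<^esub> H x) \<in> F \<rightarrow> carrier T"
    using F(2) H f by (intro funcsetI T.smult_closed) auto
qed (use F in simp_all)

lemma lin_ext_closed:
  assumes f: "f \<in> carrier L"
  shows "lin_ext T H f \<in> carrier T"
  unfolding lin_ext_def
proof (intro TR.finsum_closed funcsetI T.smult_closed)
  fix x assume "x \<in> supp f"
  with f show "H x \<in> carrier T" by (intro H) (auto simp: carrier_L)
qed (use f in simp)

lemma lin_ext_add: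
  assumes f: "f \<in> carrier L" and g: "g \<in> carrier L"
  shows "lin_ext T H (f \<oplus>\<^bsub>L\<^esub> g) = lin_ext T H f \<oplus>\<^bsub>T\<^esub> lin_ext T H g"
proof -
  let ?F = "supp f \<union> supp g"
  have F: "finite ?F" "?F \<subseteq> B"
    using f g by (simp_all add: carrier_L)
  have supp: "supp f \<subseteq> ?F" "supp g \<subseteq> ?F" "supp (f \<oplus>\<^bsub>L\<^esub> g) \<subseteq> ?F"
    by (auto simp: L_simps)
  have HF: "x \<in> ?F \<Longrightarrow> H x \<in> carrier T" for x
    using F(2) H by blast
  have "lin_ext T H (f \<oplus>\<^bsub>L\<^esub> g) = (\<Oplus>\<^bsub>T\<^esub>x\<in>?F. f x \<odot>\<^bsub>T\<^esub> H x \<oplus>\<^bsub>T\<^esub> g x \<odot>\<^bsub>T\<^esub> H x)"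
    unfolding lin_ext_eq[OF L.M.a_closed[OF f g] F supp(3)]
    using f g HF by (intro TR.finsum_cong' refl) (simp_all add: L_simps T.smult_l_distr)
  also have "\<dots> = lin_ext T H f \<oplus>\<^bsub>T\<^esub> lin_ext T H g"
    unfolding lin_ext_eq[OF f F supp(1)] lin_ext_eq[OF g F supp(2)]
    using f g HF by (intro TR.finsum_addf) simp_all
  finally show ?thesis .
qed

lemma lin_ext_smult:
  assumes k: "k \<in> carrier K" and f: "f \<in> carrier L"
  shows "lin_ext T H (k \<odot>\<^bsub>L\<^esub> f) = k \<odot>\<^bsub>T\<^esub> lin_ext T H f"
proof -
  have F: "finite (supp f)" "supp f \<subseteq> B"
    using f by (simp_all add: carrier_L)
  have supp: "supp (k \<odot>\<^bsub>L\<^esub> f) \<subseteq> supp f"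
    using k by (auto simp: L_simps)
  have HF: "x \<in> supp f \<Longrightarrow> H x \<in> carrier T" for x
    using F(2) H by blast
  have "lin_ext T H (k \<odot>\<^bsub>L\<^esub> f) = (\<Oplus>\<^bsub>T\<^esub>x\<in>supp f. k \<odot>\<^bsub>T\<^esub> (f x \<odot>\<^bsub>T\<^esub> H x))"
    unfolding lin_ext_eq[OF L.smult_closed[OF k f] F supp]
    using k f HF by (intro TR.finsum_cong' refl) (simp_all add: L_simps T.smult_assoc1)
  also have "\<dots> = k \<odot>\<^bsub>T\<^esub> lin_ext T H f"
    unfolding lin_ext_def using k f F(1) HF
    by (intro T.finsum_smult_ldistr[symmetric]) simp_all
  finally show ?thesis .
qed

lemma lin_ext_basis:
  assumes x: "x \<in> B"
  shows "lin_ext T H (basis_elem K x) = H x"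
proof -
  have "lin_ext T H (basis_elem K x) = (\<Oplus>\<^bsub>T\<^esub>y\<in>{x}. basis_elem K x y \<odot>\<^bsub>T\<^esub> H y)"
    by (rule lin_ext_eq[OF basis_closed[OF x]]) (use x in \<open>auto simp: basis_elem_def\<close>)
  also have "\<dots> = H x"
    using x H by (simp add: basis_elem_def)
  finally show ?thesis .
qed

lemma lin_ext_vec:
  assumes "set_mset M \<subseteq> B"
  shows "lin_ext T H (vec M) = mset_comb T M H"
proof -
  have "vec M x = \<zero>" if "x \<notin># M" for x
    using that by (simp add: vec_def not_in_iff)
  then have "lin_ext T H (vec M) = (\<Oplus>\<^bsub>T\<^esub>x\<in>set_mset M. vec M x \<odot>\<^bsub>T\<^esub> H x)"
    using assms by (intro lin_ext_eq vec_closed) auto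
  also have "\<dots> = mset_comb T M H"
    unfolding mset_comb_def using assms H
    by (intro TR.finsum_cong' refl) (auto simp: vec_def T.nat_smult)
  finally show ?thesis .
qed

lemma lin_ext_mult:
  assumes mult: "\<And>u v. \<lbrakk>u \<in> B; v \<in> B\<rbrakk> \<Longrightarrow> mset_comb T (m u v) H = H u \<otimes>\<^bsub>T\<^esub> H v"
    and f: "f \<in> carrier L" and g: "g \<in> carrier L"
  shows "lin_ext T H (f \<otimes>\<^bsub>L\<^esub> g) = lin_ext T H f \<otimes>\<^bsub>T\<^esub> lin_ext T H g"
  using f
proof (induction f rule: lin_induct)
  case u: (basis u)
  show ?case
    using g
  proof (induction g rule: lin_induct)
    case v: (basis v)
    have "set_mset (m u v) \<subseteq> B"
      by (intro subsetI m_in[OF u v]; assumption)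
    then show ?case
      using u v by (simp only: mult_basis lin_ext_vec lin_ext_basis mult)
  next
    case (add g g')
    then show ?case
      using u by (simp add: mult_L_linear mult_L_closed basis_closed lin_ext_add lin_ext_closed TR.r_distr)
  next
    case (smult k g)
    have "lin_ext T H (basis_elem K u) \<otimes>\<^bsub>T\<^esub> (k \<odot>\<^bsub>T\<^esub> lin_ext T H g) =
        k \<odot>\<^bsub>T\<^esub> (lin_ext T H (basis_elem K u) \<otimes>\<^bsub>T\<^esub> lin_ext T H g)"
      using smult u basis_closed lin_ext_closed T.smult_assoc2 TR.m_comm T.smult_closed by metis
    then show ?case
      using smult u by (simp add: mult_L_linear mult_L_closed basis_closed lin_ext_smult)
  qed
next
  case (add f f')
  then show ?case
    using g by (simp add: mult_L_linear mult_L_closed lin_ext_add lin_ext_closed TR.l_distr)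
next
  case (smult k f)
  then show ?case
    using g by (simp add: mult_L_linear mult_L_closed lin_ext_smult lin_ext_closed T.smult_assoc2)
qed

end

lemma alg_hom_eq_lin_ext:
  assumes T: "algebra K T" and h: "h \<in> alg_hom K L T"
    and eq: "\<And>x. x \<in> B \<Longrightarrow> H x = h (basis_elem K x)" and f: "f \<in> carrier L"
  shows "h f = lin_ext T H f"
proof -
  have H: "H x \<in> carrier T" if "x \<in> B" for x
    using that h by (simp add: eq alg_homD basis_closed)
  show ?thesis
    using f
    by (induction f rule: lin_induct)
      (simp_all add: alg_homD[OF h] eq[symmetric] lin_ext_basis[OF T H] lin_ext_add[OF T H]
        lin_ext_smult[OF T H])
qed

text \<open>The inverse of restriction to the basis is \<open>lin_ext\<close>. A linear map is
  determined by its values on the basis, and by bilinearity it is multiplicative as soon as it is so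
  on pairs of basis elements, where the product is \<open>vec (m u v)\<close>.\<close>

theorem lin_alg_universal:
  assumes T: "algebra K T"
  shows "bij_betw (\<lambda>h. \<lambda>x\<in>B. h (basis_elem K x)) (alg_hom K L T) (mult_maps T B m e)"
    (is "bij_betw ?r _ _")
  unfolding bij_betw_def
proof (intro conjI subset_antisym subsetI)
  show "inj_on ?r (alg_hom K L T)"
  proof (rule inj_onI)
    fix h h' assume h: "h \<in> alg_hom K L T" and h': "h' \<in> alg_hom K L T" and eq: "?r h = ?r h'"
    from eq have *: "h (basis_elem K x) = h' (basis_elem K x)" if "x \<in> B" for x
      using that by (metis restrict_apply')
    show "h = h'"
    proof (rule extensionalityI[OF alg_homD(6)[OF h] alg_homD(6)[OF h']])
      fix f assume "f \<in> carrier L"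
      then show "h f = h' f"
        by (induction f rule: lin_induct) (simp_all add: * alg_homD[OF h] alg_homD[OF h'])
    qed
  qed
next
  fix H assume "H \<in> ?r ` alg_hom K L T"
  then obtain h where h: "h \<in> alg_hom K L T" and H: "H = ?r h" by blast
  have "mset_comb T (m u v) H = H u \<otimes>\<^bsub>T\<^esub> H v" if u: "u \<in> B" and v: "v \<in> B" for u v
  proof -
    have m: "set_mset (m u v) \<subseteq> B"
      by (intro subsetI m_in[OF u v]; assumption)
    have HB: "H x \<in> carrier T" if "x \<in> B" for x
      using that h by (simp add: H alg_homD basis_closed)
    have "mset_comb T (m u v) H = lin_ext T H (vec (m u v))"
      by (rule lin_ext_vec[OF T HB m, symmetric])
    also have "\<dots> = h (vec (m u v))"
      by (rule alg_hom_eq_lin_ext[OF T h _ vec_closed[OF m], symmetric]) (simp add: H)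
    also have "\<dots> = H u \<otimes>\<^bsub>T\<^esub> H v"
      using u v h by (simp add: H mult_basis[symmetric] alg_homD basis_closed)
    finally show ?thesis .
  qed
  then show "H \<in> mult_maps T B m e"
    using h by (auto simp: mult_maps_def H alg_homD basis_closed L_simps[symmetric])
next
  fix H assume "H \<in> mult_maps T B m e"
  then have H: "\<And>x. x \<in> B \<Longrightarrow> H x \<in> carrier T" "H \<in> extensional B" "H e = \<one>\<^bsub>T\<^esub>"
      and mult: "\<And>u v. \<lbrakk>u \<in> B; v \<in> B\<rbrakk> \<Longrightarrow> mset_comb T (m u v) H = H u \<otimes>\<^bsub>T\<^esub> H v"
    by (auto simp: mult_maps_def PiE_def)
  interpret L: algebra K L by (rule L_algebra)
  let ?h = "\<lambda>f\<in>carrier L. lin_ext T H f"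
  have "?h \<in> alg_hom K L T"
    using lin_ext_closed[OF T H(1)] lin_ext_mult[OF T H(1) mult] lin_ext_add[OF T H(1)]
      lin_ext_smult[OF T H(1)] lin_ext_basis[OF T H(1) e_in] H(3)
    by (intro alg_homI) (simp_all add: L_simps(4) basis_closed)
  moreover have "H = ?r ?h"
    using H(2) lin_ext_basis[OF T H(1)]
    by (intro extensionalityI[of H B]) (simp_all add: basis_closed)
  ultimately show "H \<in> ?r ` alg_hom K L T" by blast
qed

end


section \<open>Quotient algebras\<close>

text \<open>Transfers the ring axioms between records of different types that share their ring
  operations, such as \<open>FactRing\<close> and \<open>alg_quot\<close>, or \<open>T\<close> and
  \<open>restrict_scalars R T\<close>.\<close>

lemma cring_cong:
  assumes "cring A" "carrier C = carrier A" "monoid.mult C = monoid.mult A" "one C = one A"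
    "zero C = zero A" "add C = add A"
  shows "cring C"
proof -
  interpret cring A by fact
  show ?thesis
    by (intro cringI abelian_groupI comm_monoidI)
      (use assms in \<open>auto simp: a_ac m_ac l_distr r_distr intro: bexI[of _ "\<ominus>\<^bsub>A\<^esub> _"] l_neg\<close>)
qed

lemma alg_quot_simps:
  "carrier (alg_quot A I) = a_rcosets\<^bsub>A\<^esub> I"
  "one (alg_quot A I) = I +>\<^bsub>A\<^esub> \<one>\<^bsub>A\<^esub>"
  "zero (alg_quot A I) = I"
  "add (alg_quot A I) = set_add A"
  "monoid.mult (alg_quot A I) = rcoset_mult A I"
  by (simp_all add: alg_quot_def FactRing_def)

lemma alg_quot_closed:
  "a \<in> carrier A \<Longrightarrow> I +>\<^bsub>A\<^esub> a \<in> carrier (alg_quot A I)"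
  by (auto simp: alg_quot_simps A_RCOSETS_def')

context
  fixes K :: "('k, 'l) ring_scheme" and A :: "('k, 'a, 'm) module_scheme" and I :: "'a set"
  assumes A: "algebra K A" and I: "ideal I A"
begin

interpretation AR: cring A by (rule algebra.M_cring[OF A])
interpretation A: algebra K A by (fact A)
interpretation I: ideal I A by (fact I)

lemma alg_quot_cases:
  assumes "C \<in> carrier (alg_quot A I)"
  obtains a where "a \<in> carrier A" "C = I +>\<^bsub>A\<^esub> a"
  using assms by (auto simp: alg_quot_simps A_RCOSETS_def')

lemma alg_quot_add:
  "\<lbrakk>a \<in> carrier A; b \<in> carrier A\<rbrakk> \<Longrightarrow>
     (I +>\<^bsub>A\<^esub> a) \<oplus>\<^bsub>alg_quot A I\<^esub> (I +>\<^bsub>A\<^esub> b) = I +>\<^bsub>A\<^esub> (a \<oplus>\<^bsub>A\<^esub> b)"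
  by (simp add: alg_quot_simps I.a_rcos_sum)

lemma alg_quot_mult:
  "\<lbrakk>a \<in> carrier A; b \<in> carrier A\<rbrakk> \<Longrightarrow>
     (I +>\<^bsub>A\<^esub> a) \<otimes>\<^bsub>alg_quot A I\<^esub> (I +>\<^bsub>A\<^esub> b) = I +>\<^bsub>A\<^esub> (a \<otimes>\<^bsub>A\<^esub> b)"
  by (simp add: alg_quot_simps I.rcoset_mult_add)

lemma coset_eq_iff:
  "\<lbrakk>a \<in> carrier A; b \<in> carrier A\<rbrakk> \<Longrightarrow> I +>\<^bsub>A\<^esub> a = I +>\<^bsub>A\<^esub> b \<longleftrightarrow> a \<ominus>\<^bsub>A\<^esub> b \<in> I"
  by (rule AR.quotient_eq_iff_same_a_r_cos[OF I, symmetric])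

text \<open>Multiplication by a scalar is multiplication by the ring element
  \<open>k \<odot> 1\<close>, so a ring ideal is automatically a submodule.\<close>

lemma ideal_smult:
  assumes k: "k \<in> carrier K" and i: "i \<in> I"
  shows "k \<odot>\<^bsub>A\<^esub> i \<in> I"
proof -
  have "k \<odot>\<^bsub>A\<^esub> i = (k \<odot>\<^bsub>A\<^esub> \<one>\<^bsub>A\<^esub>) \<otimes>\<^bsub>A\<^esub> i"
    using k i I.Icarr by (simp add: A.smult_assoc2)
  also have "\<dots> \<in> I"
    using k i by (intro I.I_l_closed A.smult_closed) simp_all
  finally show ?thesis .
qed

text \<open>The definition takes a union over all representatives of the coset. By
  \<open>ideal_smult\<close> they all yield the same coset, so the union is that coset.\<close>

lemma alg_quot_smult:
  assumes k: "k \<in> carrier K" and a: "a \<in> carrier A"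
  shows "k \<odot>\<^bsub>alg_quot A I\<^esub> (I +>\<^bsub>A\<^esub> a) = I +>\<^bsub>A\<^esub> (k \<odot>\<^bsub>A\<^esub> a)"
proof -
  have "I +>\<^bsub>A\<^esub> (k \<odot>\<^bsub>A\<^esub> y) = I +>\<^bsub>A\<^esub> (k \<odot>\<^bsub>A\<^esub> a)" if y: "y \<in> I +>\<^bsub>A\<^esub> a" for y
  proof -
    obtain i where i: "i \<in> I" "y = i \<oplus>\<^bsub>A\<^esub> a"
      using y by (auto simp: a_r_coset_def')
    have "k \<odot>\<^bsub>A\<^esub> y \<ominus>\<^bsub>A\<^esub> k \<odot>\<^bsub>A\<^esub> a = k \<odot>\<^bsub>A\<^esub> i"
      using k a i I.Icarr
      by (simp add: A.smult_r_distr a_minus_def AR.a_assoc AR.r_neg)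
    then show ?thesis
      using k a i I.Icarr by (simp add: coset_eq_iff ideal_smult)
  qed
  moreover have "a \<in> I +>\<^bsub>A\<^esub> a"
    using a by (rule I.a_rcos_self)
  ultimately show ?thesis
    unfolding alg_quot_def module.select_convs by (intro SUP_eq_const) blast+
qed

lemma alg_quot_algebra: "algebra K (alg_quot A I)"
proof (rule algebraI)
  show "cring (alg_quot A I)"
    by (rule cring_cong[OF I.quotient_is_cring[OF AR.is_cring]]) (simp_all add: alg_quot_def)
qed (auto elim!: alg_quot_cases simp: alg_quot_smult alg_quot_add alg_quot_mult alg_quot_closed
      A.smult_l_distr A.smult_r_distr A.smult_assoc1 A.smult_assoc2 algebra.R_cring[OF A])

end

text \<open>The kernel of a homomorphism is an ideal, hence it contains the ideal generated by
  \<open>G\<close> as soon as it contains \<open>G\<close>. It is thus enough to test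
  generators.\<close>

theorem alg_quot_universal:
  fixes T :: "('k, 't, 'p) module_scheme"
  assumes A: "algebra K A" and T: "algebra K T" and G: "G \<subseteq> carrier A"
  shows "bij_betw (\<lambda>h. \<lambda>a\<in>carrier A. h (Idl\<^bsub>A\<^esub> G +>\<^bsub>A\<^esub> a)) (alg_hom K (alg_quot A (Idl\<^bsub>A\<^esub> G)) T)
           {h \<in> alg_hom K A T. \<forall>g\<in>G. h g = \<zero>\<^bsub>T\<^esub>}"
    (is "bij_betw ?r (alg_hom K ?Q T) ?S")
  unfolding bij_betw_def
proof (intro conjI subset_antisym subsetI)
  interpret AR: cring A by (rule algebra.M_cring[OF A])
  interpret A: algebra K A by (fact A)
  interpret TR: cring T by (rule algebra.M_cring[OF T])
  let ?I = "Idl\<^bsub>A\<^esub> G"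
  have I: "ideal ?I A"
    by (rule AR.genideal_ideal[OF G])
  interpret I: ideal ?I A by (fact I)
  have Q: "algebra K ?Q" by (rule alg_quot_algebra[OF A I])
  note Q_simps = alg_quot_add[OF A I] alg_quot_mult[OF A I] alg_quot_smult[OF A I] alg_quot_closed
  show "inj_on ?r (alg_hom K ?Q T)"
  proof (rule inj_onI)
    fix h h' assume h: "h \<in> alg_hom K ?Q T" and h': "h' \<in> alg_hom K ?Q T" and eq: "?r h = ?r h'"
    show "h = h'"
    proof (rule extensionalityI[OF alg_homD(6)[OF h] alg_homD(6)[OF h']])
      fix C assume "C \<in> carrier ?Q"
      then obtain a where "a \<in> carrier A" "C = ?I +>\<^bsub>A\<^esub> a"
        by (rule alg_quot_cases[OF A I])
      with eq show "h C = h' C" by (metis restrict_apply')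
    qed
  qed
  {
    fix \<phi> assume "\<phi> \<in> ?r ` alg_hom K ?Q T"
    then obtain h where h: "h \<in> alg_hom K ?Q T" and \<phi>: "\<phi> = ?r h" by blast
    have "?r h \<in> alg_hom K A T"
      by (rule alg_homI)
        (simp_all add: alg_homD[OF h] Q_simps(1-3)[symmetric] alg_quot_closed alg_quot_simps(2)[symmetric])
    moreover have "?r h g = \<zero>\<^bsub>T\<^esub>" if g: "g \<in> G" for g
    proof -
      have gA: "g \<in> carrier A" using g G by blast
      have "g \<in> ?I" using AR.genideal_self[OF G] g by blast
      then have "?I +>\<^bsub>A\<^esub> g = \<zero>\<^bsub>?Q\<^esub>"
        by (simp add: alg_quot_simps I.a_rcos_const)
      moreover have "h \<zero>\<^bsub>?Q\<^esub> = \<zero>\<^bsub>T\<^esub>"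
        by (rule ring_hom_cring.hom_zero[OF alg_hom_ring_hom_cring[OF Q T h]])
      ultimately show ?thesis using gA by simp
    qed
    ultimately show "\<phi> \<in> ?S" unfolding \<phi> by blast
  }
  {
    fix \<phi> assume "\<phi> \<in> ?S"
    then have \<phi>: "\<phi> \<in> alg_hom K A T" and kill: "\<And>g. g \<in> G \<Longrightarrow> \<phi> g = \<zero>\<^bsub>T\<^esub>" by auto
    interpret \<phi>: ring_hom_cring A T \<phi>
      by (rule alg_hom_ring_hom_cring[OF A T \<phi>])
    have \<phi>R: "ring_hom_ring A T \<phi>"
      using \<phi> by (intro ring_hom_ringI2 AR.ring_axioms TR.ring_axioms) (simp add: alg_hom_def)
    have "G \<subseteq> a_kernel A T \<phi>"
      using G kill unfolding a_kernel_def' by blast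
    then have "?I \<subseteq> a_kernel A T \<phi>"
      by (rule AR.genideal_minimal[OF ring_hom_ring.kernel_is_ideal[OF \<phi>R]])
    then have I0: "\<phi> i = \<zero>\<^bsub>T\<^esub>" if "i \<in> ?I" for i
      using that unfolding a_kernel_def' by blast
    \<comment> \<open>The map \<open>\<phi>\<close> is constant on each coset, so the image of a
      coset is a singleton. Its element serves as the value of the induced homomorphism.\<close>
    have well: "the_elem (\<phi> ` (?I +>\<^bsub>A\<^esub> a)) = \<phi> a" if a: "a \<in> carrier A" for a
    proof -
      have "\<phi> ` (?I +>\<^bsub>A\<^esub> a) = {\<phi> a}"
      proof -
        have "\<phi> y = \<phi> a" if "y \<in> ?I +>\<^bsub>A\<^esub> a" for y
          using that a I0 I.Icarr by (auto simp: a_r_coset_def')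
        moreover have "a \<in> ?I +>\<^bsub>A\<^esub> a"
          using a by (rule I.a_rcos_self)
        ultimately show ?thesis by blast
      qed
      then show ?thesis by simp
    qed
    define h where "h = (\<lambda>C\<in>carrier ?Q. the_elem (\<phi> ` C))"
    have val: "h (?I +>\<^bsub>A\<^esub> a) = \<phi> a" if "a \<in> carrier A" for a
      using that by (simp add: h_def alg_quot_closed well)
    have "h \<in> alg_hom K ?Q T"
    proof (rule alg_homI)
      show "h \<one>\<^bsub>?Q\<^esub> = \<one>\<^bsub>T\<^esub>"
        unfolding alg_quot_simps(2) by (subst val) simp_all
      show "h \<in> extensional (carrier ?Q)"
        by (simp add: h_def)
    qed (auto elim!: alg_quot_cases[OF A I] simp: Q_simps val alg_homD[OF \<phi>])
    moreover have "\<phi> = ?r h"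
      by (rule extensionalityI[OF alg_homD(6)[OF \<phi>]]) (simp_all add: val)
    ultimately show "\<phi> \<in> ?r ` alg_hom K ?Q T" by blast
  }
qed

text \<open>The common step from \<open>QB\<close> to \<open>Gf\<close> and from an algebra to its
  quotient by parameters: dividing by \<open>G\<close> on the side of algebras corresponds to
  imposing \<open>P\<close> on the side of series.\<close>

lemma coeff_series_alg_quot:
  fixes T :: "('k, 't, 'p) module_scheme"
  assumes A: "algebra K A" and T: "algebra K T" and G: "G \<subseteq> carrier A"
    and c: "\<And>w. c w \<in> carrier A"
    and bij: "bij_betw (coeff_series c) (alg_hom K A T) X"
    and kill: "\<And>h. h \<in> alg_hom K A T \<Longrightarrow> (\<forall>g\<in>G. h g = \<zero>\<^bsub>T\<^esub>) \<longleftrightarrow> P (coeff_series c h)"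
  shows "bij_betw (coeff_series (\<lambda>w. Idl\<^bsub>A\<^esub> G +>\<^bsub>A\<^esub> c w)) (alg_hom K (alg_quot A (Idl\<^bsub>A\<^esub> G)) T)
           {\<Phi> \<in> X. P \<Phi>}"
proof -
  have "bij_betw (coeff_series c \<circ> (\<lambda>h. \<lambda>a\<in>carrier A. h (Idl\<^bsub>A\<^esub> G +>\<^bsub>A\<^esub> a)))
      (alg_hom K (alg_quot A (Idl\<^bsub>A\<^esub> G)) T) {\<Phi> \<in> X. P \<Phi>}"
    by (rule bij_betw_trans[OF alg_quot_universal[OF A T G]
          bij_betw_Collect[OF bij, of "\<lambda>h. \<forall>g\<in>G. h g = \<zero>\<^bsub>T\<^esub>" P, OF kill]])
  then show ?thesis
    \<comment> \<open>Every \<open>c w\<close> lies in the carrier, where the restriction in the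
      first map does nothing, so the composite is literally \<open>coeff_series\<close> of the
      classes.\<close>
    by (rule bij_betw_cong[THEN iffD1, rotated]) (simp add: coeff_series_def c fun_eq_iff)
qed

text \<open>That \<open>g \<circ> \<Phi>\<close> lies in \<open>Y\<close> is deduced from
  representability, not from the definitions of the sets of series: \<open>\<Phi>\<close> comes from
  a homomorphism, and composing that one with \<open>g\<close> gives a homomorphism to
  \<open>U\<close>.\<close>

lemma coeff_series_natural:
  assumes Q: "algebra K Q" and q: "\<And>w. q w \<in> carrier Q"
    and T: "bij_betw (coeff_series q) (alg_hom K Q T) X"
    and U: "bij_betw (coeff_series q) (alg_hom K Q U) Y"
    and g: "g \<in> alg_hom K T U"
  shows "(\<forall>\<Phi>\<in>X. g \<circ> \<Phi> \<in> Y) \<and>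
    (\<forall>h\<in>alg_hom K Q T. compose (carrier Q) g h \<in> alg_hom K Q U \<and>
       coeff_series q (compose (carrier Q) g h) = g \<circ> coeff_series q h)"
proof -
  have comp: "compose (carrier Q) g h \<in> alg_hom K Q U" if "h \<in> alg_hom K Q T" for h
    by (rule compose_alg_hom[OF g that Q])
  have eq: "coeff_series q (compose (carrier Q) g h) = g \<circ> coeff_series q h" for h
    by (simp add: coeff_series_def compose_eq q fun_eq_iff)
  have "g \<circ> \<Phi> \<in> Y" if "\<Phi> \<in> X" for \<Phi>
  proof -
    obtain h where h: "h \<in> alg_hom K Q T" "\<Phi> = coeff_series q h"
      using \<open>\<Phi> \<in> X\<close> T unfolding bij_betw_def by blast
    have "coeff_series q (compose (carrier Q) g h) \<in> Y"
      using comp[OF h(1)] U unfolding bij_betw_def by blast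
    then show ?thesis by (simp add: eq h(2))
  qed
  with comp eq show ?thesis by blast
qed

lemma coeff_series_inv_into:
  assumes "bij_betw (coeff_series q) H X" "\<Phi> \<in> X"
  shows "inv_into H (coeff_series q) \<Phi> (q w) = \<Phi> w"
  using bij_betw_inv_into_right[OF assms] by (metis coeff_series_def)


section \<open>The algebra \<open>G\<^sup>f\<close>\<close>

lemma rat_ring_cring: "cring rat_ring"
proof (intro cringI abelian_groupI comm_monoidI)
  fix x :: rat
  show "\<exists>y\<in>carrier rat_ring. y \<oplus>\<^bsub>rat_ring\<^esub> x = \<zero>\<^bsub>rat_ring\<^esub>"
    by (intro bexI[of _ "- x"]) (simp_all add: rat_ring_def)
qed (simp_all add: rat_ring_def algebra_simps)

interpretation QB: lin_alg_data rat_ring UNIV qshuffle "[]"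
  rewrites "lin_alg rat_ring UNIV qshuffle [] \<equiv> QB"
proof -
  show "lin_alg_data rat_ring UNIV qshuffle []"
    by (intro lin_alg_data.intro rat_ring_cring lin_alg_data_axioms.intro)
      (simp_all only: UNIV_I qshuffle_assoc qshuffle.simps, rule qshuffle_commute)
qed (simp add: QB_def)

lemma basis_QB: "basis_elem rat_ring w \<in> carrier QB"
  by (rule QB.basis_closed) simp

text \<open>By \<open>count_coprod_word\<close> both sums have the same index set and the same
  multiplicities. In particular the sum in \<open>coprod\<close> is finite, its index set being the
  support of a multiset.\<close>

lemma coprod_eq_mset_comb: "coprod R \<Phi> (u, v) = mset_comb R (qshuffle u v) \<Phi>"
proof -
  have "{w. (u, v) \<in># coprod_word w} = set_mset (qshuffle u v)"
    unfolding set_eq_iff mem_Collect_eq count_greater_zero_iff[symmetric] count_coprod_word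
    by simp
  then show ?thesis
    by (simp add: coprod_def mset_comb_def count_coprod_word)
qed

lemma mult_maps_qshuffle: "mult_maps R UNIV qshuffle [] = {\<Phi> \<in> series R. grouplike R \<Phi>}"
proof -
  have "coprod R \<Phi> = tensor_series R \<Phi> \<Phi> \<longleftrightarrow>
      (\<forall>u v. mset_comb R (qshuffle u v) \<Phi> = \<Phi> u \<otimes>\<^bsub>R\<^esub> \<Phi> v)" for \<Phi>
    by (simp add: fun_eq_iff tensor_series_def coprod_eq_mset_comb)
  then show ?thesis
    by (auto simp: mult_maps_def series_def grouplike_def)
qed

lemma (in abelian_monoid) tau_eq:
  assumes "\<And>w. \<Phi> w \<in> carrier G"
  shows "tau G \<Phi> v = (if v \<in> words0 then \<Phi> (tau_word v) else \<zero>)"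
  using assms by (simp add: tau_def tau_word_preimage)

lemma (in abelian_monoid) tau_Pi0:
  assumes "\<And>w. \<Phi> w \<in> carrier G"
  shows "tau G (Pi0 G \<Phi>) = (\<lambda>v. if v \<in> words0 then \<Phi> (tau_word v) else \<zero>)"
proof
  fix v
  have "Pi0 G \<Phi> w \<in> carrier G" for w
    using assms by (simp add: Pi0_def)
  from tau_eq[OF this] show "tau G (Pi0 G \<Phi>) v = (if v \<in> words0 then \<Phi> (tau_word v) else \<zero>)"
    by (simp add: Pi0_def tau_word_words0)
qed

lemma (in abelian_monoid) tau_Pi0_eq_iff:
  assumes "\<And>w. \<Phi> w \<in> carrier G"
  shows "tau G (Pi0 G \<Phi>) = Pi0 G \<Phi> \<longleftrightarrow> (\<forall>w\<in>words0. \<Phi> (tau_word w) = \<Phi> w)"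
  using tau_Pi0[OF assms] by (auto simp: Pi0_def fun_eq_iff)

definition tau_inv :: "(word \<Rightarrow> 'r) \<Rightarrow> bool" where
  "tau_inv \<Phi> \<longleftrightarrow> (\<forall>w\<in>words0. \<Phi> (tau_word w) = \<Phi> w)"

text \<open>Brings \<open>BM\<close> into the form required by \<open>coeff_series_alg_quot\<close>:
  the set of series represented by \<open>QB\<close>, cut down by the conditions that belong to the
  generators of the ideal.\<close>

lemma BM_eq:
  assumes "abelian_monoid R"
  shows "BM R = {\<Phi> \<in> mult_maps R UNIV qshuffle []. \<Phi> [0] = \<zero>\<^bsub>R\<^esub> \<and> tau_inv \<Phi>}"
  using abelian_monoid.tau_Pi0_eq_iff[OF assms]
  unfolding BM_def mult_maps_qshuffle tau_inv_def series_def by blast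

section \<open>The generators of \<open>Rel_tau0\<close>\<close>

abbreviation Pi0_rat :: "(word \<Rightarrow> rat) \<Rightarrow> word \<Rightarrow> rat" where
  "Pi0_rat \<equiv> Pi0 rat_ring"

lemma rat_ring_simps: "\<zero>\<^bsub>rat_ring\<^esub> = 0" "a \<oplus>\<^bsub>rat_ring\<^esub> b = a + b" "a \<otimes>\<^bsub>rat_ring\<^esub> b = a * b"
  "\<one>\<^bsub>rat_ring\<^esub> = 1" "carrier rat_ring = UNIV"
  by (simp_all add: rat_ring_def)

lemma tau_Pi0_rat: "tau rat_ring (Pi0_rat p) = (\<lambda>v. if v \<in> words0 then p (tau_word v) else 0)"
  using QB.tau_Pi0[of p] unfolding rat_ring_simps by simp

lemma Pi0_closed: "p \<in> carrier QB \<Longrightarrow> Pi0_rat p \<in> carrier QB"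
  unfolding QB.carrier_L rat_ring_simps
  by (auto simp: Pi0_def rat_ring_simps(1) intro: finite_subset[of _ "{w. p w \<noteq> 0}"])

lemma tau_closed:
  assumes "p \<in> carrier QB"
  shows "tau rat_ring (Pi0_rat p) \<in> carrier QB"
proof -
  \<comment> \<open>A word \<open>x\<close> in the new support is \<open>tau_word\<close> of
    \<open>tau_word x\<close>, and the latter lies in the support of \<open>p\<close>.\<close>
  have "{x. (if x \<in> words0 then p (tau_word x) else 0) \<noteq> 0} \<subseteq> tau_word ` {x. p x \<noteq> 0}"
    by (auto simp: image_iff split: if_splits) (metis tau_word_tau_word)
  moreover have "finite (tau_word ` {x. p x \<noteq> 0})"
    using assms by (simp add: QB.carrier_L rat_ring_simps)
  ultimately have "finite {x. (if x \<in> words0 then p (tau_word x) else 0) \<noteq> 0}"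
    by (rule finite_subset)
  then show ?thesis
    unfolding QB.carrier_L rat_ring_simps tau_Pi0_rat by simp
qed

definition tau_relations :: "(word \<Rightarrow> rat) set" where
  "tau_relations = {basis_elem rat_ring [0]} \<union>
     {p \<ominus>\<^bsub>QB\<^esub> tau rat_ring p |p. p \<in> carrier QB \<and> (\<forall>w. w \<notin> words0 \<longrightarrow> p w = 0)}"

text \<open>Indexing the relations linearly by all of \<open>QB\<close> makes them accessible to \<open>lin_induct\<close>.\<close>

lemma tau_relations_eq:
  "tau_relations = {basis_elem rat_ring [0]} \<union>
     (\<lambda>p. Pi0_rat p \<ominus>\<^bsub>QB\<^esub> tau rat_ring (Pi0_rat p)) ` carrier QB"
proof -
  have "{p. p \<in> carrier QB \<and> (\<forall>w. w \<notin> words0 \<longrightarrow> p w = 0)} = Pi0_rat ` carrier QB"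
  proof (intro subset_antisym subsetI)
    fix p assume "p \<in> {p. p \<in> carrier QB \<and> (\<forall>w. w \<notin> words0 \<longrightarrow> p w = 0)}"
    then have "p \<in> carrier QB" "p = Pi0_rat p"
      by (auto simp: Pi0_def rat_ring_simps)
    then show "p \<in> Pi0_rat ` carrier QB" by blast
  qed (auto simp: Pi0_closed, simp add: Pi0_def rat_ring_simps)
  moreover have "{p \<ominus>\<^bsub>QB\<^esub> tau rat_ring p |p. p \<in> carrier QB \<and> (\<forall>w. w \<notin> words0 \<longrightarrow> p w = 0)} =
      (\<lambda>p. p \<ominus>\<^bsub>QB\<^esub> tau rat_ring p) ` {p. p \<in> carrier QB \<and> (\<forall>w. w \<notin> words0 \<longrightarrow> p w = 0)}"
    by (rule setcompr_eq_image)
  ultimately show ?thesis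
    unfolding tau_relations_def by (simp only: image_image)
qed

lemma Pi0_basis:
  "Pi0_rat (basis_elem rat_ring w) = (if w \<in> words0 then basis_elem rat_ring w else \<zero>\<^bsub>QB\<^esub>)"
  by (auto simp: Pi0_def basis_elem_def QB.L_simps rat_ring_simps fun_eq_iff)

lemma tau_basis:
  assumes "w \<in> words0"
  shows "tau rat_ring (basis_elem rat_ring w) = basis_elem rat_ring (tau_word w)"
proof -
  have "tau rat_ring (basis_elem rat_ring w) =
      (\<lambda>v. if v \<in> words0 then basis_elem rat_ring w (tau_word v) else 0)"
    using tau_Pi0_rat[of "basis_elem rat_ring w"] assms by (simp add: Pi0_basis)
  also have "\<dots> = basis_elem rat_ring (tau_word w)"
    using assms by (auto simp: basis_elem_def rat_ring_simps fun_eq_iff tau_word_words0 tau_word_tau_word)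
  finally show ?thesis .
qed

lemma tau_zero: "tau rat_ring \<zero>\<^bsub>QB\<^esub> = \<zero>\<^bsub>QB\<^esub>"
proof -
  have "Pi0_rat \<zero>\<^bsub>QB\<^esub> = \<zero>\<^bsub>QB\<^esub>"
    by (auto simp: Pi0_def QB.L_simps)
  then show ?thesis
    using tau_Pi0_rat[of "\<zero>\<^bsub>QB\<^esub>"] by (auto simp: QB.L_simps rat_ring_simps)
qed

lemma Pi0_linear:
  "Pi0_rat (f \<oplus>\<^bsub>QB\<^esub> g) = Pi0_rat f \<oplus>\<^bsub>QB\<^esub> Pi0_rat g"
  "Pi0_rat (k \<odot>\<^bsub>QB\<^esub> f) = k \<odot>\<^bsub>QB\<^esub> Pi0_rat f"
  by (auto simp: Pi0_def QB.L_simps rat_ring_simps fun_eq_iff)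

lemma tau_Pi0_linear:
  "tau rat_ring (Pi0_rat f \<oplus>\<^bsub>QB\<^esub> Pi0_rat g) =
     tau rat_ring (Pi0_rat f) \<oplus>\<^bsub>QB\<^esub> tau rat_ring (Pi0_rat g)"
  "tau rat_ring (k \<odot>\<^bsub>QB\<^esub> Pi0_rat f) = k \<odot>\<^bsub>QB\<^esub> tau rat_ring (Pi0_rat f)"
  unfolding Pi0_linear[symmetric] tau_Pi0_rat
  by (auto simp: QB.L_simps rat_ring_simps fun_eq_iff)

lemma QB_algebra: "algebra rat_ring QB"
  by (rule QB.L_algebra)

lemma tau_relations_carrier: "tau_relations \<subseteq> carrier QB"
  unfolding tau_relations_eq
  by (auto intro!: basis_QB abelian_group.minus_closed[OF QB.L_abelian_group] Pi0_closed tau_closed)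

text \<open>The condition on all \<open>p - tau p\<close> is linear in \<open>p\<close>, so it can
  be tested on words, where it compares the coefficients of \<open>w\<close> and
  \<open>tau_word w\<close>.\<close>

lemma tau_relations_kill_iff:
  assumes R: "algebra rat_ring R" and h: "h \<in> alg_hom rat_ring QB R"
  shows "(\<forall>g\<in>tau_relations. h g = \<zero>\<^bsub>R\<^esub>) \<longleftrightarrow>
    coeff_series (basis_elem rat_ring) h [0] = \<zero>\<^bsub>R\<^esub> \<and> tau_inv (coeff_series (basis_elem rat_ring) h)"
proof -
  interpret cring R by (rule algebra.M_cring[OF R])
  let ?b = "basis_elem rat_ring"
  have "h (Pi0_rat p \<ominus>\<^bsub>QB\<^esub> tau rat_ring (Pi0_rat p)) = \<zero>\<^bsub>R\<^esub> \<longleftrightarrow>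
      h (tau rat_ring (Pi0_rat p)) = h (Pi0_rat p)" if "p \<in> carrier QB" for p
    using that h by (auto simp: alg_hom_minus[OF QB_algebra R] Pi0_closed tau_closed
        minus_eq_zero_iff alg_homD)
  then have "(\<forall>g\<in>tau_relations. h g = \<zero>\<^bsub>R\<^esub>) \<longleftrightarrow> h (?b [0]) = \<zero>\<^bsub>R\<^esub> \<and>
      (\<forall>p\<in>carrier QB. h (tau rat_ring (Pi0_rat p)) = h (Pi0_rat p))"
    unfolding tau_relations_eq by simp
  also have "(\<forall>p\<in>carrier QB. h (tau rat_ring (Pi0_rat p)) = h (Pi0_rat p)) \<longleftrightarrow>
      (\<forall>w\<in>words0. h (?b (tau_word w)) = h (?b w))"
  proof
    assume *: "\<forall>p\<in>carrier QB. h (tau rat_ring (Pi0_rat p)) = h (Pi0_rat p)"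
    show "\<forall>w\<in>words0. h (?b (tau_word w)) = h (?b w)"
    proof
      fix w :: word assume "w \<in> words0"
      with *[rule_format, OF basis_QB[of w]] show "h (?b (tau_word w)) = h (?b w)"
        by (simp add: Pi0_basis tau_basis tau_zero)
    qed
  next
    assume *: "\<forall>w\<in>words0. h (?b (tau_word w)) = h (?b w)"
    show "\<forall>p\<in>carrier QB. h (tau rat_ring (Pi0_rat p)) = h (Pi0_rat p)"
    proof
      fix p assume "p \<in> carrier QB"
      then show "h (tau rat_ring (Pi0_rat p)) = h (Pi0_rat p)"
      proof (induction p rule: QB.lin_induct)
        case (basis w)
        \<comment> \<open>For words outside \<open>words0\<close> the projection vanishes, and both
          sides are the value of \<open>h\<close> at zero.\<close>
        then show ?case using * by (simp add: Pi0_basis tau_basis tau_zero)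
      next
        case (add f g)
        then show ?case
          by (simp add: Pi0_linear tau_Pi0_linear alg_homD[OF h] Pi0_closed tau_closed)
      next
        case (smult k f)
        then show ?case
          by (simp add: Pi0_linear tau_Pi0_linear alg_homD[OF h] Pi0_closed tau_closed)
      qed
    qed
  qed
  finally show ?thesis
    by (simp add: coeff_series_def tau_inv_def)
qed

lemma Rel_tau0_eq: "Rel_tau0 = Idl\<^bsub>QB\<^esub> tau_relations"
  by (simp add: Rel_tau0_def tau_relations_def)

lemma Rel_tau0_ideal: "ideal Rel_tau0 QB"
proof -
  interpret cring QB by (rule algebra.M_cring[OF QB_algebra])
  show ?thesis
    unfolding Rel_tau0_eq by (rule genideal_ideal[OF tau_relations_carrier])
qed

lemma Gf_algebra: "algebra rat_ring Gf"
  unfolding Gf_def by (rule alg_quot_algebra[OF QB_algebra Rel_tau0_ideal])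

lemma f_class_closed: "f_class w \<in> carrier Gf"
  unfolding Gf_def f_class_def by (rule alg_quot_closed[OF basis_QB])

theorem Gf_represents_BM:
  assumes R: "algebra rat_ring R"
  shows "bij_betw (coeff_series f_class) (alg_hom rat_ring Gf R) (BM R)"
proof -
  interpret cring R by (rule algebra.M_cring[OF R])
  have "bij_betw (coeff_series (basis_elem rat_ring)) (alg_hom rat_ring QB R)
      (mult_maps R UNIV qshuffle [])"
    \<comment> \<open>The basis consists of all words, so restricting to it changes nothing and the
      universal bijection is \<open>coeff_series\<close>.\<close>
    using QB.lin_alg_universal[OF R] by (simp add: coeff_series_def[abs_def] restrict_UNIV)
  from coeff_series_alg_quot[OF QB_algebra R tau_relations_carrier basis_QB this
      tau_relations_kill_iff[OF R]]
  show ?thesis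
    unfolding BM_eq[OF abelian_monoid_axioms] Gf_def Rel_tau0_eq f_class_def[abs_def] .
qed


section \<open>Quotients prescribing the coefficients of \<open>b_2\<close>, \<open>b_4\<close>,
  \<open>b_6\<close>\<close>

context
  fixes K :: "('k, 'l) ring_scheme" and A :: "('k, 'a, 'm) module_scheme"
    and c :: "word \<Rightarrow> 'a" and l m n :: 'k
  assumes A: "algebra K A" and c: "\<And>w. c w \<in> carrier A"
    and lmn: "l \<in> carrier K" "m \<in> carrier K" "n \<in> carrier K"
begin

interpretation AR: cring A by (rule algebra.M_cring[OF A])
interpretation A: algebra K A by (fact A)

lemma param_relations_carrier:
  "{c [2] \<ominus>\<^bsub>A\<^esub> (l \<odot>\<^bsub>A\<^esub> \<one>\<^bsub>A\<^esub>), c [4] \<ominus>\<^bsub>A\<^esub> (m \<odot>\<^bsub>A\<^esub> \<one>\<^bsub>A\<^esub>), c [6] \<ominus>\<^bsub>A\<^esub> (n \<odot>\<^bsub>A\<^esub> \<one>\<^bsub>A\<^esub>)}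
     \<subseteq> carrier A"
  using c lmn by simp

lemma param_quot_algebra: "algebra K (param_quot A c l m n)"
  unfolding param_quot_def param_ideal_def
  by (intro alg_quot_algebra[OF A] AR.genideal_ideal param_relations_carrier)

lemma param_class_closed: "param_class A c l m n w \<in> carrier (param_quot A c l m n)"
  unfolding param_quot_def param_class_def by (rule alg_quot_closed[OF c])

text \<open>A homomorphism over \<open>K\<close> sends \<open>k \<odot> 1\<close> to
  \<open>k \<odot> 1\<close>, so killing \<open>c w - k \<odot> 1\<close> prescribes the coefficient
  at \<open>w\<close>. The base \<open>K\<close> is arbitrary, since the lemma serves both
  \<open>Gf\<close> over the rationals and its extension of scalars over \<open>R\<close>.\<close>

lemma param_quot_represents:
  fixes T :: "('k, 't, 'p) module_scheme"
  assumes T: "algebra K T"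
    and bij: "bij_betw (coeff_series c) (alg_hom K A T) (BM T)"
  shows "bij_betw (coeff_series (param_class A c l m n)) (alg_hom K (param_quot A c l m n) T)
           (BM_param T (l \<odot>\<^bsub>T\<^esub> \<one>\<^bsub>T\<^esub>) (m \<odot>\<^bsub>T\<^esub> \<one>\<^bsub>T\<^esub>) (n \<odot>\<^bsub>T\<^esub> \<one>\<^bsub>T\<^esub>))"
proof -
  interpret TR: cring T by (rule algebra.M_cring[OF T])
  interpret T: algebra K T by (fact T)
  have *: "h (c w \<ominus>\<^bsub>A\<^esub> (k \<odot>\<^bsub>A\<^esub> \<one>\<^bsub>A\<^esub>)) = \<zero>\<^bsub>T\<^esub> \<longleftrightarrow> coeff_series c h w = k \<odot>\<^bsub>T\<^esub> \<one>\<^bsub>T\<^esub>"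
    if "h \<in> alg_hom K A T" "k \<in> carrier K" for h k w
    using that c
    by (simp add: alg_hom_minus[OF A T] alg_homD TR.minus_eq_zero_iff coeff_series_def)
  show ?thesis
    unfolding param_quot_def param_class_def[abs_def] param_ideal_def BM_param_def
    by (rule coeff_series_alg_quot[OF A T param_relations_carrier c bij]) (simp add: * lmn)
qed

end


section \<open>Base change\<close>

text \<open>An \<open>R\<close>-algebra seen over \<open>K\<close> through the structure map of
  \<open>R\<close>. As a functor this is right adjoint to \<open>base_change\<close>
  (\<open>base_change_universal\<close>).\<close>

definition restrict_scalars ::
  "('k, 'r, 'm) module_scheme \<Rightarrow> ('r, 't, 'p) module_scheme \<Rightarrow> ('k, 't) module" where
  "restrict_scalars R T = \<lparr>carrier = carrier T, monoid.mult = monoid.mult T, one = one T,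
     zero = zero T, add = add T, smult = (\<lambda>k t. (k \<odot>\<^bsub>R\<^esub> \<one>\<^bsub>R\<^esub>) \<odot>\<^bsub>T\<^esub> t)\<rparr>"

lemma restrict_scalars_simps [simp]:
  "carrier (restrict_scalars R T) = carrier T"
  "monoid.mult (restrict_scalars R T) = monoid.mult T"
  "one (restrict_scalars R T) = one T"
  "zero (restrict_scalars R T) = zero T"
  "add (restrict_scalars R T) = add T"
  "smult (restrict_scalars R T) = (\<lambda>k t. (k \<odot>\<^bsub>R\<^esub> \<one>\<^bsub>R\<^esub>) \<odot>\<^bsub>T\<^esub> t)"
  by (simp_all add: restrict_scalars_def)

lemma self_alg_simps [simp]:
  "carrier (self_alg R) = carrier R"
  "monoid.mult (self_alg R) = monoid.mult R"
  "one (self_alg R) = one R"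
  "zero (self_alg R) = zero R"
  "add (self_alg R) = add R"
  "smult (self_alg R) = monoid.mult R"
  by (simp_all add: self_alg_def)

lemma self_alg_algebra:
  assumes "cring R"
  shows "algebra R (self_alg R)"
proof -
  interpret cring R by fact
  show ?thesis
    by (rule algebraI) (auto simp: l_distr r_distr m_assoc is_cring intro: cring_cong[OF is_cring])
qed

lemma restrict_scalars_algebra:
  assumes R: "algebra K R" and T: "algebra R T"
  shows "algebra K (restrict_scalars R T)"
proof -
  interpret RR: cring R by (rule algebra.M_cring[OF R])
  interpret R: algebra K R by (fact R)
  interpret T: algebra R T by (fact T)
  have mult: "(k \<otimes>\<^bsub>K\<^esub> l) \<odot>\<^bsub>R\<^esub> \<one>\<^bsub>R\<^esub> = (k \<odot>\<^bsub>R\<^esub> \<one>\<^bsub>R\<^esub>) \<otimes>\<^bsub>R\<^esub> (l \<odot>\<^bsub>R\<^esub> \<one>\<^bsub>R\<^esub>)"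
    if "k \<in> carrier K" "l \<in> carrier K" for k l
    using that by (simp add: R.smult_assoc1 R.smult_assoc2)
  show ?thesis
    by (rule algebraI)
      (simp_all add: algebra.R_cring[OF R] cring_cong[OF algebra.M_cring[OF T]] R.smult_l_distr
        T.smult_l_distr T.smult_r_distr T.smult_assoc1 T.smult_assoc2 mult)
qed

text \<open>Every ingredient of \<open>BM\<close> is built from the ring operations alone, so
  \<open>BM\<close> is the same for an algebra over different base rings.\<close>

lemma BM_cong:
  assumes "carrier C = carrier A" "monoid.mult C = monoid.mult A" "one C = one A"
    "zero C = zero A" "add C = add A"
  shows "BM C = BM A"
proof -
  have finsum: "finsum C f S = finsum A f S" for f :: "word \<Rightarrow> _" and S
    using assms by (simp add: finsum_def finprod_def)
  have add_pow: "[k] \<cdot>\<^bsub>C\<^esub> a = [k] \<cdot>\<^bsub>A\<^esub> a" for k :: nat and a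
    using assms by (simp add: add_pow_def nat_pow_def)
  have "coprod C \<Phi> = coprod A \<Phi>" "tau C \<Phi> = tau A \<Phi>" "Pi0 C \<Phi> = Pi0 A \<Phi>"
    "tensor_series C \<Phi> \<Phi> = tensor_series A \<Phi> \<Phi>" for \<Phi>
    by (simp_all add: coprod_def tau_def Pi0_def tensor_series_def finsum add_pow assms cong: if_cong)
  then show ?thesis
    by (simp add: BM_def series_def grouplike_def assms)
qed

section \<open>The tensor product and its universal property\<close>

context
  fixes K :: "('k, 'l) ring_scheme" and R :: "('k, 'r, 'm) module_scheme"
    and A :: "('k, 'a, 'n) module_scheme"
  assumes R: "algebra K R" and A: "algebra K A"
begin

interpretation RR: cring R by (rule algebra.M_cring[OF R])
interpretation R: algebra K R by (fact R)
interpretation AR: cring A by (rule algebra.M_cring[OF A])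
interpretation A: algebra K A by (fact A)

text \<open>The algebra of symbols is the monoid algebra over \<open>R\<close> of the multiplicative
  monoid of \<open>A\<close>; associativity and commutativity of the product on the basis are those
  of \<open>A\<close>.\<close>

interpretation S: lin_alg_data R "carrier A" "\<lambda>a b. {#a \<otimes>\<^bsub>A\<^esub> b#}" "\<one>\<^bsub>A\<^esub>"
  rewrites "lin_alg R (carrier A) (\<lambda>a b. {#a \<otimes>\<^bsub>A\<^esub> b#}) \<one>\<^bsub>A\<^esub> \<equiv> symbol_alg R A"
proof -
  show "lin_alg_data R (carrier A) (\<lambda>a b. {#a \<otimes>\<^bsub>A\<^esub> b#}) \<one>\<^bsub>A\<^esub>"
    by (intro lin_alg_data.intro RR.is_cring lin_alg_data_axioms.intro)
      (auto simp: AR.m_ac)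
qed (simp add: symbol_alg_def)

definition tensor_relations :: "('a \<Rightarrow> 'r) set" where
  "tensor_relations =
     {basis_elem R (a \<oplus>\<^bsub>A\<^esub> b) \<ominus>\<^bsub>symbol_alg R A\<^esub>
         (basis_elem R a \<oplus>\<^bsub>symbol_alg R A\<^esub> basis_elem R b) |a b. a \<in> carrier A \<and> b \<in> carrier A} \<union>
      {basis_elem R (k \<odot>\<^bsub>A\<^esub> a) \<ominus>\<^bsub>symbol_alg R A\<^esub>
         ((k \<odot>\<^bsub>R\<^esub> \<one>\<^bsub>R\<^esub>) \<odot>\<^bsub>symbol_alg R A\<^esub> basis_elem R a) |k a. k \<in> carrier K \<and> a \<in> carrier A}"

lemma tensor_ideal_eq: "tensor_ideal K R A = Idl\<^bsub>symbol_alg R A\<^esub> tensor_relations"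
  by (simp add: tensor_ideal_def tensor_relations_def)

lemma tensor_relations_carrier: "tensor_relations \<subseteq> carrier (symbol_alg R A)"
  unfolding tensor_relations_def
  by (auto intro!: abelian_group.minus_closed[OF S.L_abelian_group] S.L.M.a_closed S.L.smult_closed
      S.basis_closed)

lemma base_change_algebra: "algebra R (base_change K R A)"
proof -
  interpret SR: cring "symbol_alg R A" by (rule algebra.M_cring[OF S.L_algebra])
  show ?thesis
    unfolding base_change_def tensor_ideal_eq
    by (intro alg_quot_algebra[OF S.L_algebra] ring.genideal_ideal[OF SR.ring_axioms]
        tensor_relations_carrier)
qed

lemma one_tensor_closed: "a \<in> carrier A \<Longrightarrow> one_tensor K R A a \<in> carrier (base_change K R A)"
  unfolding one_tensor_def base_change_def by (intro alg_quot_closed S.basis_closed)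

text \<open>Products of symbols have one term, so the condition in \<open>mult_maps\<close> is plain
  multiplicativity. Adding additivity and homogeneity gives exactly the algebra homomorphisms over
  \<open>K\<close>.\<close>

lemma mult_maps_linear_eq:
  fixes T :: "('r, 't, 'p) module_scheme"
  assumes T: "algebra R T"
  shows "{H \<in> mult_maps T (carrier A) (\<lambda>a b. {#a \<otimes>\<^bsub>A\<^esub> b#}) \<one>\<^bsub>A\<^esub>.
      (\<forall>a\<in>carrier A. \<forall>b\<in>carrier A. H (a \<oplus>\<^bsub>A\<^esub> b) = H a \<oplus>\<^bsub>T\<^esub> H b) \<and>
      (\<forall>k\<in>carrier K. \<forall>a\<in>carrier A. H (k \<odot>\<^bsub>A\<^esub> a) = (k \<odot>\<^bsub>R\<^esub> \<one>\<^bsub>R\<^esub>) \<odot>\<^bsub>T\<^esub> H a)} =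
    alg_hom K A (restrict_scalars R T)"
proof -
  interpret TR: cring T by (rule algebra.M_cring[OF T])
  have comb: "mset_comb T {#a#} H = H a" if "H a \<in> carrier T" for H :: "'a \<Rightarrow> 't" and a
    using that by (simp add: mset_comb_def)
  show ?thesis
  proof (intro subset_antisym subsetI)
    fix H assume "H \<in> {H \<in> mult_maps T (carrier A) (\<lambda>a b. {#a \<otimes>\<^bsub>A\<^esub> b#}) \<one>\<^bsub>A\<^esub>.
      (\<forall>a\<in>carrier A. \<forall>b\<in>carrier A. H (a \<oplus>\<^bsub>A\<^esub> b) = H a \<oplus>\<^bsub>T\<^esub> H b) \<and>
      (\<forall>k\<in>carrier K. \<forall>a\<in>carrier A. H (k \<odot>\<^bsub>A\<^esub> a) = (k \<odot>\<^bsub>R\<^esub> \<one>\<^bsub>R\<^esub>) \<odot>\<^bsub>T\<^esub> H a)}"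
    then have H: "\<And>a. a \<in> carrier A \<Longrightarrow> H a \<in> carrier T" "H \<in> extensional (carrier A)"
      "H \<one>\<^bsub>A\<^esub> = \<one>\<^bsub>T\<^esub>"
      "\<And>a b. \<lbrakk>a \<in> carrier A; b \<in> carrier A\<rbrakk> \<Longrightarrow> mset_comb T {#a \<otimes>\<^bsub>A\<^esub> b#} H = H a \<otimes>\<^bsub>T\<^esub> H b"
      "\<And>a b. \<lbrakk>a \<in> carrier A; b \<in> carrier A\<rbrakk> \<Longrightarrow> H (a \<oplus>\<^bsub>A\<^esub> b) = H a \<oplus>\<^bsub>T\<^esub> H b"
      "\<And>k a. \<lbrakk>k \<in> carrier K; a \<in> carrier A\<rbrakk> \<Longrightarrow> H (k \<odot>\<^bsub>A\<^esub> a) = (k \<odot>\<^bsub>R\<^esub> \<one>\<^bsub>R\<^esub>) \<odot>\<^bsub>T\<^esub> H a"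
      by (simp_all add: mult_maps_def PiE_def Pi_def)
    have "H (a \<otimes>\<^bsub>A\<^esub> b) = H a \<otimes>\<^bsub>T\<^esub> H b" if "a \<in> carrier A" "b \<in> carrier A" for a b
      using H(4)[OF that] H(1) that by (simp add: comb)
    then show "H \<in> alg_hom K A (restrict_scalars R T)"
      by (intro alg_homI) (simp_all add: H)
  next
    fix H assume H: "H \<in> alg_hom K A (restrict_scalars R T)"
    note H = alg_homD[OF H, simplified]
    show "H \<in> {H \<in> mult_maps T (carrier A) (\<lambda>a b. {#a \<otimes>\<^bsub>A\<^esub> b#}) \<one>\<^bsub>A\<^esub>.
      (\<forall>a\<in>carrier A. \<forall>b\<in>carrier A. H (a \<oplus>\<^bsub>A\<^esub> b) = H a \<oplus>\<^bsub>T\<^esub> H b) \<and>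
      (\<forall>k\<in>carrier K. \<forall>a\<in>carrier A. H (k \<odot>\<^bsub>A\<^esub> a) = (k \<odot>\<^bsub>R\<^esub> \<one>\<^bsub>R\<^esub>) \<odot>\<^bsub>T\<^esub> H a)}"
      by (simp add: mult_maps_def PiE_def Pi_def H comb)
  qed
qed

text \<open>The two families of relations correspond, one to one, to the two properties that a
  multiplicative map on \<open>A\<close> still lacks.\<close>

lemma tensor_relations_kill_iff:
  fixes T :: "('r, 't, 'p) module_scheme"
  assumes T: "algebra R T" and h: "h \<in> alg_hom R (symbol_alg R A) T"
  defines "H \<equiv> \<lambda>a\<in>carrier A. h (basis_elem R a)"
  shows "(\<forall>g\<in>tensor_relations. h g = \<zero>\<^bsub>T\<^esub>) \<longleftrightarrow>
    (\<forall>a\<in>carrier A. \<forall>b\<in>carrier A. H (a \<oplus>\<^bsub>A\<^esub> b) = H a \<oplus>\<^bsub>T\<^esub> H b) \<and>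
    (\<forall>k\<in>carrier K. \<forall>a\<in>carrier A. H (k \<odot>\<^bsub>A\<^esub> a) = (k \<odot>\<^bsub>R\<^esub> \<one>\<^bsub>R\<^esub>) \<odot>\<^bsub>T\<^esub> H a)"
proof -
  interpret TR: cring T by (rule algebra.M_cring[OF T])
  interpret T: algebra R T by (fact T)
  note h_simps = alg_hom_minus[OF S.L_algebra T h] alg_homD[OF h] S.basis_closed
    TR.minus_eq_zero_iff
  have H: "H a = h (basis_elem R a)" if "a \<in> carrier A" for a
    using that by (simp add: H_def)
  have 1: "h (basis_elem R (a \<oplus>\<^bsub>A\<^esub> b) \<ominus>\<^bsub>symbol_alg R A\<^esub>
         (basis_elem R a \<oplus>\<^bsub>symbol_alg R A\<^esub> basis_elem R b)) = \<zero>\<^bsub>T\<^esub> \<longleftrightarrow>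
      H (a \<oplus>\<^bsub>A\<^esub> b) = H a \<oplus>\<^bsub>T\<^esub> H b" if "a \<in> carrier A" "b \<in> carrier A" for a b
    using that by (simp add: h_simps H)
  have 2: "h (basis_elem R (k \<odot>\<^bsub>A\<^esub> a) \<ominus>\<^bsub>symbol_alg R A\<^esub>
         ((k \<odot>\<^bsub>R\<^esub> \<one>\<^bsub>R\<^esub>) \<odot>\<^bsub>symbol_alg R A\<^esub> basis_elem R a)) = \<zero>\<^bsub>T\<^esub> \<longleftrightarrow>
      H (k \<odot>\<^bsub>A\<^esub> a) = (k \<odot>\<^bsub>R\<^esub> \<one>\<^bsub>R\<^esub>) \<odot>\<^bsub>T\<^esub> H a" if "k \<in> carrier K" "a \<in> carrier A" for k a
    using that by (simp add: h_simps H)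
  show ?thesis
    unfolding tensor_relations_def using 1 2 by blast
qed

text \<open>The adjunction between extension and restriction of scalars, obtained by composing the
  universal properties of the monoid algebra and of its quotient by the tensor relations.\<close>

theorem base_change_universal:
  fixes T :: "('r, 't, 'p) module_scheme"
  assumes T: "algebra R T"
  shows "bij_betw (\<lambda>h. \<lambda>a\<in>carrier A. h (one_tensor K R A a)) (alg_hom R (base_change K R A) T)
           (alg_hom K A (restrict_scalars R T))"
proof -
  let ?S = "symbol_alg R A"
  let ?P = "\<lambda>H. (\<forall>a\<in>carrier A. \<forall>b\<in>carrier A. H (a \<oplus>\<^bsub>A\<^esub> b) = H a \<oplus>\<^bsub>T\<^esub> H b) \<and>
      (\<forall>k\<in>carrier K. \<forall>a\<in>carrier A. H (k \<odot>\<^bsub>A\<^esub> a) = (k \<odot>\<^bsub>R\<^esub> \<one>\<^bsub>R\<^esub>) \<odot>\<^bsub>T\<^esub> H a)"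
  have "bij_betw ((\<lambda>h. \<lambda>a\<in>carrier A. h (basis_elem R a)) \<circ>
      (\<lambda>h. \<lambda>f\<in>carrier ?S. h (Idl\<^bsub>?S\<^esub> tensor_relations +>\<^bsub>?S\<^esub> f)))
      (alg_hom R (alg_quot ?S (Idl\<^bsub>?S\<^esub> tensor_relations)) T)
      {H \<in> mult_maps T (carrier A) (\<lambda>a b. {#a \<otimes>\<^bsub>A\<^esub> b#}) \<one>\<^bsub>A\<^esub>. ?P H}"
    by (rule bij_betw_trans[OF alg_quot_universal[OF S.L_algebra T tensor_relations_carrier]
          bij_betw_Collect[OF S.lin_alg_universal[OF T],
            of "\<lambda>h. \<forall>g\<in>tensor_relations. h g = \<zero>\<^bsub>T\<^esub>" ?P, OF tensor_relations_kill_iff[OF T]]])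
  then show ?thesis
    unfolding mult_maps_linear_eq[OF T] base_change_def tensor_ideal_eq one_tensor_def
    by (rule bij_betw_cong[THEN iffD1, rotated])
      (auto simp: S.basis_closed fun_eq_iff restrict_def)
qed

lemma base_change_represents:
  fixes T :: "('r, 't, 'p) module_scheme"
  assumes T: "algebra R T" and c: "\<And>w. c w \<in> carrier A"
    and bij: "bij_betw (coeff_series c) (alg_hom K A (restrict_scalars R T)) X"
  shows "bij_betw (coeff_series (\<lambda>w. one_tensor K R A (c w))) (alg_hom R (base_change K R A) T) X"
  using bij_betw_trans[OF base_change_universal[OF T] bij]
  by (rule bij_betw_cong[THEN iffD1, rotated]) (simp add: coeff_series_def c fun_eq_iff)

end


section \<open>Representability over \<open>R\<close> and the final theorem\<close>

lemma BM_restrict_scalars: "BM (restrict_scalars R T) = BM T"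
  by (rule BM_cong) simp_all

lemma BM_param_self_alg: "BM_param (self_alg R) l m n = BM_param R l m n"
  unfolding BM_param_def by (simp add: BM_cong[of "self_alg R" R])

text \<open>An \<open>R\<close>-algebra and its underlying rational algebra have the same
  \<open>BM\<close>, so the adjunction carries \<open>Gf_represents_BM\<close> over to the extension
  of scalars.\<close>

lemma Gf_base_change_represents:
  assumes R: "algebra rat_ring R" and T: "algebra R T"
  shows "bij_betw (coeff_series (\<lambda>w. one_tensor rat_ring R Gf (f_class w)))
           (alg_hom R (base_change rat_ring R Gf) T) (BM T)"
  using Gf_represents_BM[OF restrict_scalars_algebra[OF R T]]
  unfolding BM_restrict_scalars
  by (rule base_change_represents[OF R Gf_algebra T f_class_closed])

theorem theorem6p2:
  fixes R :: "(rat, 'r, 'm) module_scheme"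
    and S :: "(rat, 's, 'n) module_scheme"
    and T :: "('r, 't, 'p) module_scheme"
    and U :: "('r, 'u, 'q) module_scheme"
    and l m n :: 'r
    and x y z :: rat
  assumes R: "algebra rat_ring R"
    and lmn: "l \<in> carrier R" "m \<in> carrier R" "n \<in> carrier R"
  shows
    \<comment> \<open>\<open>BM\<close> is represented by \<open>G\<^sup>f\<close>: bijection, its inverse, and naturality\<close>
    "(algebra rat_ring Gf \<and>
      bij_betw (coeff_series f_class) (alg_hom rat_ring Gf R) (BM R) \<and>
      (\<forall>\<Phi>\<in>BM R. \<forall>w. inv_into (alg_hom rat_ring Gf R) (coeff_series f_class) \<Phi> (f_class w) = \<Phi> w) \<and>
      (algebra rat_ring S \<longrightarrow> (\<forall>g\<in>alg_hom rat_ring R S.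
        (\<forall>\<Phi>\<in>BM R. g \<circ> \<Phi> \<in> BM S) \<and>
        (\<forall>\<phi>\<in>alg_hom rat_ring Gf R.
          compose (carrier Gf) g \<phi> \<in> alg_hom rat_ring Gf S \<and>
          coeff_series f_class (compose (carrier Gf) g \<phi>) = g \<circ> coeff_series f_class \<phi>)))) \<and>
    \<comment> \<open>parameters \<open>l, m, n\<close> in \<open>R\<close>: the quotient is one of \<open>R \<otimes> G\<^sup>f\<close>, an \<open>R\<close>-algebra, and
       represents the functor on \<open>R\<close>-algebras; the value at \<open>R\<close> itself comes first\<close>
     (let G = base_change rat_ring R Gf;
          c = (\<lambda>w. one_tensor rat_ring R Gf (f_class w));
          Q = param_quot G c l m n;
          q = param_class G c l m n
      in algebra R Q \<and>
         bij_betw (coeff_series q) (alg_hom R Q (self_alg R)) (BM_param R l m n) \<and>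
         (\<forall>\<Phi>\<in>BM_param R l m n. \<forall>w.
            inv_into (alg_hom R Q (self_alg R)) (coeff_series q) \<Phi> (q w) = \<Phi> w) \<and>
         (algebra R T \<longrightarrow>
            bij_betw (coeff_series q) (alg_hom R Q T)
              (BM_param T (l \<odot>\<^bsub>T\<^esub> \<one>\<^bsub>T\<^esub>) (m \<odot>\<^bsub>T\<^esub> \<one>\<^bsub>T\<^esub>) (n \<odot>\<^bsub>T\<^esub> \<one>\<^bsub>T\<^esub>)) \<and>
            (algebra R U \<longrightarrow> (\<forall>g\<in>alg_hom R T U.
              (\<forall>\<Phi>\<in>BM_param T (l \<odot>\<^bsub>T\<^esub> \<one>\<^bsub>T\<^esub>) (m \<odot>\<^bsub>T\<^esub> \<one>\<^bsub>T\<^esub>) (n \<odot>\<^bsub>T\<^esub> \<one>\<^bsub>T\<^esub>).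
                 g \<circ> \<Phi> \<in> BM_param U (l \<odot>\<^bsub>U\<^esub> \<one>\<^bsub>U\<^esub>) (m \<odot>\<^bsub>U\<^esub> \<one>\<^bsub>U\<^esub>) (n \<odot>\<^bsub>U\<^esub> \<one>\<^bsub>U\<^esub>)) \<and>
              (\<forall>\<psi>\<in>alg_hom R Q T.
                 compose (carrier Q) g \<psi> \<in> alg_hom R Q U \<and>
                 coeff_series q (compose (carrier Q) g \<psi>) = g \<circ> coeff_series q \<psi>))))) \<and>
    \<comment> \<open>rational parameters \<open>x, y, z\<close>: the quotient is one of \<open>G\<^sup>f\<close> itself and represents the
       functor on commutative algebras over the rationals\<close>
     (let Q = param_quot Gf f_class x y z;
          q = param_class Gf f_class x y z
      in algebra rat_ring Q \<and>
         bij_betw (coeff_series q) (alg_hom rat_ring Q R)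
           (BM_param R (x \<odot>\<^bsub>R\<^esub> \<one>\<^bsub>R\<^esub>) (y \<odot>\<^bsub>R\<^esub> \<one>\<^bsub>R\<^esub>) (z \<odot>\<^bsub>R\<^esub> \<one>\<^bsub>R\<^esub>)) \<and>
         (\<forall>\<Phi>\<in>BM_param R (x \<odot>\<^bsub>R\<^esub> \<one>\<^bsub>R\<^esub>) (y \<odot>\<^bsub>R\<^esub> \<one>\<^bsub>R\<^esub>) (z \<odot>\<^bsub>R\<^esub> \<one>\<^bsub>R\<^esub>). \<forall>w.
            inv_into (alg_hom rat_ring Q R) (coeff_series q) \<Phi> (q w) = \<Phi> w) \<and>
         (algebra rat_ring S \<longrightarrow> (\<forall>g\<in>alg_hom rat_ring R S.
           (\<forall>\<Phi>\<in>BM_param R (x \<odot>\<^bsub>R\<^esub> \<one>\<^bsub>R\<^esub>) (y \<odot>\<^bsub>R\<^esub> \<one>\<^bsub>R\<^esub>) (z \<odot>\<^bsub>R\<^esub> \<one>\<^bsub>R\<^esub>).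
              g \<circ> \<Phi> \<in> BM_param S (x \<odot>\<^bsub>S\<^esub> \<one>\<^bsub>S\<^esub>) (y \<odot>\<^bsub>S\<^esub> \<one>\<^bsub>S\<^esub>) (z \<odot>\<^bsub>S\<^esub> \<one>\<^bsub>S\<^esub>)) \<and>
           (\<forall>\<psi>\<in>alg_hom rat_ring Q R.
              compose (carrier Q) g \<psi> \<in> alg_hom rat_ring Q S \<and>
              coeff_series q (compose (carrier Q) g \<psi>) = g \<circ> coeff_series q \<psi>))))"
proof -
  interpret RR: cring R by (rule algebra.M_cring[OF R])
  let ?G = "base_change rat_ring R Gf" and ?c = "\<lambda>w. one_tensor rat_ring R Gf (f_class w)"
  let ?Q = "param_quot ?G ?c l m n" and ?q = "param_class ?G ?c l m n"
  let ?Q' = "param_quot Gf f_class x y z" and ?q' = "param_class Gf f_class x y z"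

  note Gf = Gf_represents_BM[OF R]
  note Gf_nat = coeff_series_natural[OF Gf_algebra f_class_closed Gf Gf_represents_BM]

  have c: "?c w \<in> carrier ?G" for w
    by (rule one_tensor_closed[OF R Gf_algebra f_class_closed])
  note G = base_change_algebra[OF R Gf_algebra]
  note Q = param_quot_algebra[OF G c lmn]
  \<comment> \<open>The condition on the test algebra stays open twice, once from the quotient and
    once from the extension of scalars. Hence the doubled instantiations below.\<close>
  note Q_rep = param_quot_represents[OF G c lmn _ Gf_base_change_represents[OF R]]
  note Q_nat = coeff_series_natural[OF Q param_class_closed[OF G c lmn] Q_rep Q_rep]
  have self: "algebra R (self_alg R)"
    by (rule self_alg_algebra[OF RR.is_cring])
  \<comment> \<open>In \<open>self_alg R\<close> the scalar multiple \<open>l \<odot> 1\<close> is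
    the product of \<open>l\<close> and 1, so the parameters become \<open>l\<close>,
    \<open>m\<close>, \<open>n\<close> themselves.\<close>
  have Q_self: "bij_betw (coeff_series ?q) (alg_hom R ?Q (self_alg R)) (BM_param R l m n)"
    using Q_rep[OF self self] lmn by (simp add: BM_param_self_alg)

  have xyz: "x \<in> carrier rat_ring" "y \<in> carrier rat_ring" "z \<in> carrier rat_ring"
    by (simp_all add: rat_ring_simps)
  note Q' = param_quot_algebra[OF Gf_algebra f_class_closed xyz]
  note Q'_rep = param_quot_represents[OF Gf_algebra f_class_closed xyz _ Gf_represents_BM]
  note Q'_nat = coeff_series_natural[OF Q' param_class_closed[OF Gf_algebra f_class_closed xyz]
      Q'_rep[OF R R] Q'_rep]

  show ?thesis
    unfolding Let_def
    by (intro conjI[OF conjI[OF Gf_algebra conjI[OF Gf conjI]]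
          conjI[OF conjI[OF Q conjI[OF Q_self conjI]] conjI[OF Q' conjI[OF Q'_rep[OF R R] conjI]]]]
        conjI[OF Q_rep] ballI allI impI Gf_nat Q_nat Q'_nat
        coeff_series_inv_into[OF Gf] coeff_series_inv_into[OF Q_self]
        coeff_series_inv_into[OF Q'_rep[OF R R]]) assumption+
qed

end
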